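(* Let $A=\int_0^\infty \frac{\{t\}^2}{t^2}\,dt$ and let $g(x)=\sum_{l\ge 1}\frac{1-2\{lx\}}{l}$. There is an absolute constant $C>0$ such that, for $K\in\mathbb{N}$, $$\int_0^1|g(x)|^K\,dx=2e^{-A}\,\Gamma(K+1)\bigl(1+O(\exp(-CK))\bigr)\qquad (K\to\infty).$$
   Context: $\{t\}=t-\lfloor t\rfloor$ denotes the fractional part and $\Gamma$ the Gamma function. The series defining $g$ is the limit of its partial sums $\sum_{l=1}^N$ as $N\to\infty$; it converges for almost every $x\in(0,1)$, so $g$ is defined almost everywhere. The implied constant in $O(\cdot)$ is absolute. *)

theory Defs
  imports "HOL-Analysis.Analysis" "HOL-Library.Landau_Symbols"
begin

definition A_const :: real where
  "A_const = (LINT t:{0<..}|lborel. (frac t)\<^sup>2 / t\<^sup>2)"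

text \<open>
  The index is shifted by one. The series is only conditionally convergent; \<^term>\<open>suminf\<close> is
  the limit of the partial sums, and an unspecified value at the (null set of) points of
  \<open>(0,1)\<close> where that limit does not exist.
\<close>
definition g :: "real \<Rightarrow> real" where
  "g x = (\<Sum>l. (1 - 2 * frac (real (Suc l) * x)) / real (Suc l))"

end

theory Submission
  imports Defs "HOL-Real_Asymp.Real_Asymp"
begin

text \<open>
  Write \<open>S\<^sub>n(x)\<close> for the partial sums of \<open>g\<close>. Counting the lattice points under the line of slope \<open>x\<close>
  in two ways gives, for irrational \<open>x\<close> in \<open>(0,1)\<close>, a reciprocity formula
  \<open>S\<^sub>n(x) + x S\<^sub>m(1/x) \<rightarrow> F(x)\<close> with \<open>m = \<lfloor>nx\<rfloor>\<close> and \<open>F(x) = ln (1/x) - A + O(x)\<close>; the constant \<open>A\<close>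
  enters as the constant of Stirling's formula. On \<open>(0,1/2)\<close> the factor \<open>x\<close> halves the contribution of
  \<open>1/x\<close>, and since the sums are periodic and odd the inversion \<open>x \<mapsto> 1/x\<close> maps back into the same
  situation. This self-improvement bounds the integral of \<open>sup\<^sub>n exp (3/4 |S\<^sub>n|)\<close> and forces the
  oscillation of \<open>S\<^sub>n\<close> to vanish almost everywhere, so that
  \<open>g(x) = ln (1/x) - A + O(x + x |g(1/x)|)\<close> almost everywhere. The logarithm alone contributes
  exactly \<open>exp (-A) K!\<close> on \<open>(0, exp (-A))\<close>, and replacing \<open>g\<close> by it costs \<open>O(K! (4/5)\<^sup>K)\<close> because the
  error term gains a power of \<open>x\<close>.
\<close>

section \<open>Sawtooth sums and harmonic numbers\<close>

text \<open>Minus twice the first periodic Bernoulli function, but with the value 1 instead of 0 at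
  the integers. That value breaks oddness there, which is why reflections are stated for irrational
  arguments only.\<close>

definition saw :: "real \<Rightarrow> real" where
  "saw t = 1 - 2 * frac t"

definition saw_sum :: "nat \<Rightarrow> real \<Rightarrow> real" where
  "saw_sum n x = (\<Sum>l=1..n. saw (real l * x) / real l)"

lemma saw_bounds: "\<bar>saw t\<bar> \<le> 1"
  unfolding saw_def using frac_ge_0[of t] frac_lt_1[of t] by linarith

lemma saw_add_of_int [simp]: "saw (t + of_int k) = saw t"
  by (simp add: saw_def frac_def)

lemma saw_minus:
  assumes "t \<notin> \<int>"
  shows "saw (-t) = - saw t"
  using assms by (simp add: saw_def frac_neg)

lemma Rats_of_mult_nat:
  assumes "real l * x \<in> \<int>" "l > 0"
  shows "x \<in> \<rat>"
proof -
  from assms(1) obtain k where "real l * x = of_int k" by (auto elim: Ints_cases)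
  hence "x = of_int k / of_nat l" using assms(2) by (simp add: field_simps)
  thus ?thesis by simp
qed

lemma saw_sum_add_of_int: "saw_sum n (x + of_int k) = saw_sum n x"
proof -
  have "saw (real l * (x + of_int k)) = saw (real l * x)" for l
    using saw_add_of_int[of "real l * x" "int l * k"] by (simp add: algebra_simps)
  thus ?thesis by (simp add: saw_sum_def)
qed

lemma saw_sum_minus:
  assumes "x \<notin> \<rat>"
  shows "saw_sum n (-x) = - saw_sum n x"
proof -
  have "saw (real l * (-x)) = - saw (real l * x)" if "l \<in> {1..n}" for l
    using saw_minus[of "real l * x"] Rats_of_mult_nat[of l x] assms that by auto
  thus ?thesis by (simp add: saw_sum_def sum_negf)
qed

lemma abs_saw_sum_le: "\<bar>saw_sum n x\<bar> \<le> harm n"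
proof -
  have "\<bar>saw_sum n x\<bar> \<le> (\<Sum>l=1..n. \<bar>saw (real l * x) / real l\<bar>)"
    unfolding saw_sum_def by (rule sum_abs)
  also have "\<dots> \<le> (\<Sum>l=1..n. inverse (real l))"
    using saw_bounds by (intro sum_mono) (auto simp: abs_mult divide_simps)
  finally show ?thesis by (simp add: harm_def)
qed

lemma saw_sum_measurable [measurable]: "saw_sum n \<in> borel_measurable borel"
  unfolding saw_sum_def saw_def frac_def by measurable

lemma g_conv_saw_sum:
  assumes "(\<lambda>n. saw_sum n x) \<longlonglongrightarrow> L"
  shows "g x = L"
proof -
  have eq: "(\<Sum>l<n. (1 - 2 * frac (real (Suc l) * x)) / real (Suc l)) = saw_sum n x" for n
    unfolding saw_sum_def saw_def
    by (rule sum.reindex_bij_witness[of _ "\<lambda>l. l - 1" Suc]) auto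
  have "(\<lambda>l. (1 - 2 * frac (real (Suc l) * x)) / real (Suc l)) sums L"
    unfolding sums_def eq by (rule assms)
  thus ?thesis unfolding g_def by (rule sums_unique[symmetric])
qed

section \<open>Harmonic numbers at real arguments\<close>

lemma ln_one_plus_ge_quadratic:
  fixes u :: real
  assumes "u \<ge> 0"
  shows "ln (1 + u) \<ge> u - u\<^sup>2 / 2"
proof -
  have "ln (1 + 0) - (0 - 0\<^sup>2 / 2) \<le> ln (1 + u) - (u - u\<^sup>2 / 2)"
  proof (rule DERIV_nonneg_imp_nondecreasing[OF assms])
    fix x :: real assume x: "0 \<le> x" "x \<le> u"
    have "((\<lambda>x. ln (1 + x) - (x - x\<^sup>2 / 2)) has_real_derivative (1 / (1 + x) - (1 - x))) (at x)"
      using x by (auto intro!: derivative_eq_intros)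
    moreover have "1 / (1 + x) - (1 - x) \<ge> 0"
      using x by (simp add: field_simps)
    ultimately show "\<exists>y. ((\<lambda>x. ln (1 + x) - (x - x\<^sup>2 / 2)) has_real_derivative y) (at x) \<and> 0 \<le> y"
      by blast
  qed
  thus ?thesis by simp
qed

text \<open>The second-order remainder in the Euler-Maclaurin expansion of the harmonic numbers at a
  real argument \<open>z\<close>. The sawtooth term of first order is the source of the sum at
  \<open>1 / x\<close> in the reciprocity formula.\<close>

definition harm_error :: "real \<Rightarrow> real" where
  "harm_error z = harm (nat \<lfloor>z\<rfloor>) - ln z - euler_mascheroni - saw z / (2 * z)"

text \<open>The known two-sided bounds for the Euler-Mascheroni constant involve
  \<open>ln (real n + 1)\<close>. Writing \<open>n + 1 = z * (1 + w)\<close> transfers them to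
  \<open>ln z\<close>, at the cost of \<open>ln (1 + w) - w\<close>, which is of order
  \<open>1 / z^2\<close>.\<close>

lemma abs_harm_error_le:
  assumes z: "z \<ge> 1"
  shows "\<bar>harm_error z\<bar> \<le> 2 / z\<^sup>2"
proof -
  define n where "n = nat \<lfloor>z\<rfloor>"
  define \<theta> where "\<theta> = frac z"
  define w where "w = (1 - \<theta>) / z"
  have n1: "n \<ge> 1" using z by (simp add: n_def le_nat_iff)
  have zn: "z = real n + \<theta>" using z by (simp add: n_def \<theta>_def frac_def)
  have th: "0 \<le> \<theta>" "\<theta> < 1" by (simp_all add: \<theta>_def frac_lt_1)
  obtain m where m: "n = Suc m" using n1 by (cases n) auto
  have lo: "harm n - ln (real n + 1) + 1 / (2 * (real n + 1)) \<le> euler_mascheroni"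
    and up: "euler_mascheroni \<le> harm n - ln (real n + 1) + 1 / (2 * real n)"
    using euler_mascheroni_lower[of m] euler_mascheroni_upper[of m] by (simp_all add: m add_ac)
  have w0: "w \<ge> 0" using th z by (simp add: w_def)
  have eq1: "real n + 1 = z * (1 + w)" using z by (simp add: w_def zn field_simps)
  have lnn: "ln (real n + 1) = ln z + ln (1 + w)"
    unfolding eq1 using z w0 by (simp add: ln_mult)
  have lw: "w - w\<^sup>2 / 2 \<le> ln (1 + w)" "ln (1 + w) \<le> w"
    using ln_one_plus_ge_quadratic[OF w0] ln_add_one_self_le_self[OF w0] by auto
  have w2: "w\<^sup>2 \<le> 1 / z\<^sup>2"
    unfolding w_def power_divide using th by (intro divide_right_mono) (auto simp: power_le_one)
  \<comment> \<open>The sawtooth term is the linear term \<open>w\<close> up to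
    \<open>1 / (2 * z)\<close>, which in turn nearly cancels the correction in the bounds
    \<open>lo\<close> and \<open>up\<close>.\<close>
  have sw: "saw z / (2 * z) = w - 1 / (2 * z)"
    using z by (simp add: saw_def w_def \<theta>_def[symmetric] field_simps)
  have he: "harm_error z = harm n - ln (real n + 1) - euler_mascheroni + (ln (1 + w) - w) + 1 / (2 * z)"
    unfolding harm_error_def n_def[symmetric] sw lnn by simp
  have "harm_error z \<le> 1 / (2 * z) - 1 / (2 * (real n + 1))"
    using he lo lw by simp
  also have "\<dots> = (1 - \<theta>) / (2 * z * (real n + 1))"
    using z by (simp add: zn divide_simps) (simp add: algebra_simps)
  also have "\<dots> \<le> 1 / (2 * z * z)"
    using z th by (intro frac_le mult_left_mono) (auto simp: zn)
  also have "\<dots> \<le> 2 / z\<^sup>2"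
    using z by (simp add: power2_eq_square divide_simps)
  finally have A: "harm_error z \<le> 2 / z\<^sup>2" .
  have "z \<le> 2 * real n" using zn th n1 by linarith
  hence "\<theta> / (2 * z * real n) \<le> 1 / z\<^sup>2"
    using z n1 th mult_mono[of \<theta> 1 z "2 * real n"]
    by (simp add: power2_eq_square divide_simps)
  moreover have "1 / (2 * real n) - 1 / (2 * z) = \<theta> / (2 * z * real n)"
    using z n1 by (simp add: zn divide_simps)
  ultimately have "- harm_error z \<le> 1 / z\<^sup>2 + 1 / z\<^sup>2 / 2"
    using he up lw w2 by simp
  also have "\<dots> \<le> 2 / z\<^sup>2" using z by (simp add: field_simps)
  finally show ?thesis using A by simp
qed

section \<open>The constant A and the reciprocity formula\<close>

text \<open>
  The integral of \<open>(frac t)\<^sup>2 / t\<^sup>2\<close> over \<open>[n, n + 1)\<close>. For \<open>n = 0\<close> the junk value \<open>ln (1 / 0) = 0\<close>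
  is harmless because of the factor \<open>n\<close>.
\<close>
definition frac_sq_term :: "nat \<Rightarrow> real" where
  "frac_sq_term n = 1 - 2 * real n * ln ((real n + 1) / real n) + real n / (real n + 1)"

text \<open>The integral over \<open>[0, N)\<close> telescopes to the remainder in Stirling's
  formula. Read backwards, it expresses \<open>ln (fact N)\<close> through a partial sum for
  \<open>A_const\<close>; this is how the constant enters the reciprocity formula.\<close>

lemma sum_frac_sq_term:
  assumes "N \<ge> 1"
  shows "(\<Sum>n<N. frac_sq_term n) = 2 * ln (fact N) - 2 * real N * ln (real N) + 2 * real N - harm N"
  using assms
proof (induction N rule: nat_induct_at_least)
  case base
  show ?case by (simp add: frac_sq_term_def harm_def)
next
  case (Suc n)
  have l: "ln ((real n + 1) / real n) = ln (real n + 1) - ln (real n)"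
    using Suc.hyps by (simp add: ln_div)
  have f: "ln (fact (Suc n)) = ln (real n + 1) + ln (fact n)"
    by (simp add: ln_mult add_ac)
  have q: "real n / (real n + 1) = 1 - 1 / (real n + 1)" by (simp add: field_simps)
  have h: "harm (Suc n) = harm n + 1 / (real n + 1)"
    by (simp add: harm_Suc inverse_eq_divide add_ac)
  have t: "frac_sq_term n = 2 - 2 * real n * ln (real n + 1) + 2 * real n * ln (real n) - 1 / (real n + 1)"
    unfolding frac_sq_term_def l q by (simp add: algebra_simps)
  show ?case
    unfolding sum.lessThan_Suc Suc.IH f h t of_nat_Suc by (simp add: algebra_simps)
qed

lemma frac_sq_term_le:
  assumes "n \<ge> 1"
  shows "frac_sq_term n \<le> 1 / (real n)\<^sup>2"
proof -
  have "ln ((real n + 1) / real n) \<ge> 1 / real n - (1 / real n)\<^sup>2 / 2"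
    using ln_one_plus_ge_quadratic[of "1 / real n"] assms by (simp add: field_simps)
  hence "2 * real n * ln ((real n + 1) / real n) \<ge> 2 * real n * (1 / real n - (1 / real n)\<^sup>2 / 2)"
    by (intro mult_left_mono) auto
  also have "2 * real n * (1 / real n - (1 / real n)\<^sup>2 / 2) = 2 - 1 / real n"
    using assms by (simp add: field_simps power2_eq_square)
  finally have "2 * real n * ln ((real n + 1) / real n) \<ge> 2 - 1 / real n" .
  moreover have "real n / (real n + 1) = 1 - 1 / (real n + 1)" by (simp add: field_simps)
  ultimately have "frac_sq_term n \<le> 1 / real n - 1 / (real n + 1)"
    unfolding frac_sq_term_def by linarith
  also have "\<dots> = 1 / (real n * (real n + 1))"
    using assms by (simp add: field_simps)
  also have "\<dots> \<le> 1 / (real n)\<^sup>2"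
    using assms by (intro frac_le) (auto simp: power2_eq_square)
  finally show ?thesis .
qed

lemma
  shows frac_sq_term_nonneg: "frac_sq_term n \<ge> 0"
    and nn_integral_frac_sq:
      "(\<integral>\<^sup>+t. ennreal ((frac t)\<^sup>2 / t\<^sup>2) * indicator {real n..<real n + 1} t \<partial>lborel)
         = ennreal (frac_sq_term n)"
proof -
  \<comment> \<open>The expanded form of \<open>(t - n)^2 / t^2\<close>. For \<open>n = 0\<close> it
    is constantly 1 even at \<open>t = 0\<close>, where the quotient has the default value 0, so
    that \<open>F\<close> has derivative \<open>f\<close> on the whole closed interval.\<close>
  define f where "f = (\<lambda>t. 1 - 2 * real n / t + (real n)\<^sup>2 / t\<^sup>2)"
  define F where "F = (\<lambda>t. t - 2 * real n * ln t - (real n)\<^sup>2 / t)"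
  have feq: "f t = (t - real n)\<^sup>2 / t\<^sup>2" if "t \<noteq> 0" for t
    using that by (simp add: f_def field_simps power2_eq_square)
  have f0: "f t \<ge> 0" if "real n \<le> t" for t
    using feq[of t] by (cases "t = 0") (auto simp: f_def)
  have der: "(F has_real_derivative f t) (at t)" if "real n \<le> t" for t
  proof (cases "n = 0")
    case True
    thus ?thesis by (simp add: F_def f_def)
  next
    case False
    thus ?thesis using that unfolding F_def f_def
      by (auto intro!: derivative_eq_intros simp: power2_eq_square)
  qed
  have FF: "F (real n + 1) - F (real n) = frac_sq_term n"
    by (cases "n = 0")
       (simp_all add: F_def frac_sq_term_def ln_div field_simps power2_eq_square)
  have "F (real n) \<le> F (real n + 1)"
    by (rule DERIV_nonneg_imp_nondecreasing) (use der f0 in auto)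
  thus "frac_sq_term n \<ge> 0" using FF by simp
  have fm: "f \<in> borel_measurable borel" unfolding f_def by measurable
  have "AE t in lborel. t \<notin> {real n, real n + 1}"
    by (rule AE_not_in) (intro finite_imp_null_set_lborel, simp)
  hence "AE t in lborel. ennreal ((frac t)\<^sup>2 / t\<^sup>2) * indicator {real n..<real n + 1} t
     = ennreal (f t) * indicator {real n..real n + 1} t"
  proof eventually_elim
    case (elim t)
    have "frac t = t - real n" if "real n < t" "t < real n + 1"
    proof -
      have "\<lfloor>t\<rfloor> = int n" using that by (intro floor_unique) auto
      thus ?thesis by (simp add: frac_def)
    qed
    thus ?case using elim by (auto simp: indicator_def feq)
  qed
  hence "(\<integral>\<^sup>+t. ennreal ((frac t)\<^sup>2 / t\<^sup>2) * indicator {real n..<real n + 1} t \<partial>lborel)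
     = (\<integral>\<^sup>+t. ennreal (f t) * indicator {real n..real n + 1} t \<partial>lborel)"
    by (rule nn_integral_cong_AE)
  also have "\<dots> = F (real n + 1) - F (real n)"
    by (rule nn_integral_FTC_Icc[OF fm]) (use der f0 in \<open>auto intro: has_field_derivative_at_within\<close>)
  finally show "(\<integral>\<^sup>+t. ennreal ((frac t)\<^sup>2 / t\<^sup>2) * indicator {real n..<real n + 1} t \<partial>lborel)
         = ennreal (frac_sq_term n)" by (simp add: FF)
qed

lemma frac_sq_term_sums: "frac_sq_term sums A_const"
proof -
  have 1: "summable (\<lambda>n. 1 / (real (Suc n))\<^sup>2)"
    using inverse_squares_sums by (auto simp: sums_iff add_ac)
  have 2: "norm (frac_sq_term (Suc n)) \<le> 1 / (real (Suc n))\<^sup>2" for n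
    using frac_sq_term_le[of "Suc n"] frac_sq_term_nonneg[of "Suc n"] by simp
  have "summable (\<lambda>n. frac_sq_term (Suc n))"
    by (rule summable_comparison_test'[OF 1, of 0, OF 2])
  hence sm: "summable frac_sq_term" by (simp only: summable_Suc_iff)
  have U: "(\<Union>n. {real n..<real n + 1}) = {0..}"
  proof (intro equalityI subsetI)
    fix t :: real assume "t \<in> {0..}"
    hence "t \<in> {real (nat \<lfloor>t\<rfloor>)..<real (nat \<lfloor>t\<rfloor>) + 1}" by auto
    thus "t \<in> (\<Union>n. {real n..<real n + 1})" by blast
  qed auto
  have disj: "disjoint_family (\<lambda>n. {real n..<real n + 1})"
    unfolding disjoint_family_on_def by (auto; linarith)
  \<comment> \<open>The union of the intervals contains 0, which the domain of
    \<open>A_const\<close> omits; the integrand is 0 there by the convention for division by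
    zero.\<close>
  have "(\<integral>\<^sup>+t. ennreal ((frac t)\<^sup>2 / t\<^sup>2) * indicator {0<..} t \<partial>lborel)
     = (\<integral>\<^sup>+t. ennreal ((frac t)\<^sup>2 / t\<^sup>2) * indicator (\<Union>n. {real n..<real n + 1}) t \<partial>lborel)"
    by (rule nn_integral_cong) (auto simp: U indicator_def)
  also have "\<dots> = (\<Sum>n. \<integral>\<^sup>+t. ennreal ((frac t)\<^sup>2 / t\<^sup>2) * indicator {real n..<real n + 1} t \<partial>lborel)"
    by (rule nn_integral_disjoint_family) (use disj in \<open>auto simp: frac_def\<close>)
  also have "\<dots> = (\<Sum>n. ennreal (frac_sq_term n))" by (simp add: nn_integral_frac_sq)
  also have "\<dots> = ennreal (suminf frac_sq_term)"
    by (rule suminf_ennreal2) (use sm frac_sq_term_nonneg in auto)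
  finally have "(\<integral>\<^sup>+t. ennreal ((frac t)\<^sup>2 / t\<^sup>2) * indicator {0<..} t \<partial>lborel) = ennreal (suminf frac_sq_term)" .
  moreover have "A_const = enn2real (\<integral>\<^sup>+t. ennreal (indicator {0<..} t *\<^sub>R ((frac t)\<^sup>2 / t\<^sup>2)) \<partial>lborel)"
    unfolding A_const_def set_lebesgue_integral_def
    by (rule integral_eq_nn_integral) (auto simp: frac_def)
  moreover have "(\<integral>\<^sup>+t. ennreal (indicator {0<..} t *\<^sub>R ((frac t)\<^sup>2 / t\<^sup>2)) \<partial>lborel)
     = (\<integral>\<^sup>+t. ennreal ((frac t)\<^sup>2 / t\<^sup>2) * indicator {0<..} t \<partial>lborel)"
    by (rule nn_integral_cong) (auto simp: indicator_def)
  ultimately have "A_const = suminf frac_sq_term"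
    using suminf_nonneg[OF sm frac_sq_term_nonneg] by simp
  thus ?thesis using sm by (simp add: sums_iff)
qed

text \<open>Both sides sum \<open>1 / l\<close> over the lattice points \<open>(l, m)\<close> with \<open>m \<le> l x\<close> and \<open>1 \<le> l \<le> n\<close>.\<close>
lemma sum_floor_mult_div:
  fixes x :: real
  assumes x: "x > 0" "x \<notin> \<rat>"
  defines "M \<equiv> (\<lambda>l. nat \<lfloor>real l * x\<rfloor>)"
  shows "(\<Sum>l=1..n. real (M l) / real l) = (\<Sum>m=1..M n. harm n - harm (nat \<lfloor>real m / x\<rfloor>))"
proof -
  have A: "real (M l) / real l = (\<Sum>m=1..M n. if m \<le> M l then 1 / real l else 0)" if "l \<in> {1..n}" for l
  proof -
    have "M l \<le> M n" unfolding M_def using that x by (intro nat_mono floor_mono mult_right_mono) auto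
    hence "{1..M n} \<inter> {m. m \<le> M l} = {1..M l}" by auto
    thus ?thesis by (simp add: sum.If_cases)
  qed
  have B: "(\<Sum>l=1..n. if m \<le> M l then 1 / real l else 0) = harm n - harm (nat \<lfloor>real m / x\<rfloor>)"
    if m: "m \<in> {1..M n}" for m
  proof -
    define q where "q = nat \<lfloor>real m / x\<rfloor>"
    have iff: "m \<le> M l \<longleftrightarrow> q < l" for l
    proof -
      have "m \<le> M l \<longleftrightarrow> real m \<le> real l * x"
        unfolding M_def using m x by (simp add: le_nat_floor le_nat_iff le_floor_iff)
      also have "\<dots> \<longleftrightarrow> real m / x \<le> real l" using x by (simp add: field_simps)
      also have "\<dots> \<longleftrightarrow> real m / x < real l"
      proof -
        \<comment> \<open>Irrationality of \<open>x\<close> keeps lattice points off the line, so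
          the inequality is strict and the condition becomes \<open>q < l\<close>.\<close>
        have "real m / x \<noteq> real l"
        proof
          assume "real m / x = real l"
          hence "x = real m / real l" using x m by (cases "l = 0") (auto simp: field_simps)
          thus False using x by simp
        qed
        thus ?thesis by linarith
      qed
      also have "\<dots> \<longleftrightarrow> q < l"
        unfolding q_def using x by (simp add: nat_less_iff floor_less_iff)
      finally show ?thesis .
    qed
    have qn: "q < n" using iff[of n] m by simp
    have "(\<Sum>l=1..n. if m \<le> M l then 1 / real l else 0) = (\<Sum>l\<in>{1..n} \<inter> {l. q < l}. 1 / real l)"
      by (simp add: iff sum.If_cases)
    also have "{1..n} \<inter> {l. q < l} = {1..n} - {1..q}" by auto
    also have "(\<Sum>l\<in>{1..n} - {1..q}. 1 / real l) = harm n - harm q"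
      using qn by (subst sum_diff) (auto simp: harm_def inverse_eq_divide)
    finally show ?thesis by (simp add: q_def)
  qed
  have "(\<Sum>l=1..n. real (M l) / real l) = (\<Sum>l=1..n. \<Sum>m=1..M n. if m \<le> M l then 1 / real l else 0)"
    using A by (intro sum.cong) auto
  also have "\<dots> = (\<Sum>m=1..M n. \<Sum>l=1..n. if m \<le> M l then 1 / real l else 0)"
    by (rule sum.swap)
  also have "\<dots> = (\<Sum>m=1..M n. harm n - harm (nat \<lfloor>real m / x\<rfloor>))"
    using B by (intro sum.cong) auto
  finally show ?thesis .
qed

section \<open>The reciprocity formula and its error terms\<close>

lemma ln_fact_eq_sum: "ln (fact n) = (\<Sum>m=1..n. ln (real m))"
  by (induction n) (auto simp: ln_mult)

text \<open>Splitting off the integer part of \<open>l * x\<close> leaves the lattice point sum,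
  which becomes a sum of harmonic numbers at the integer parts of \<open>m / x\<close>. In their
  expansion the sawtooth terms reassemble to the sum at \<open>1 / x\<close>, and the logarithms to
  \<open>ln (fact M)\<close>.\<close>

lemma saw_sum_reciprocity:
  fixes x :: real and n :: nat
  assumes x: "x > 0" "x \<notin> \<rat>"
  defines "M \<equiv> nat \<lfloor>real n * x\<rfloor>"
  shows "saw_sum n x + x * saw_sum M (1 / x) =
    harm n - 2 * x * real n + 2 * real M * (harm n + ln x - euler_mascheroni) - 2 * ln (fact M)
      - 2 * (\<Sum>m=1..M. harm_error (real m / x))"
proof -
  have "saw_sum n x = (\<Sum>l=1..n. inverse (real l) - 2 * x + 2 * (real (nat \<lfloor>real l * x\<rfloor>) / real l))"
    unfolding saw_sum_def saw_def frac_def using x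
    by (intro sum.cong) (auto simp: field_simps)
  also have "\<dots> = harm n - 2 * x * real n + 2 * (\<Sum>l=1..n. real (nat \<lfloor>real l * x\<rfloor>) / real l)"
    by (simp add: sum.distrib sum_subtractf harm_def sum_distrib_left)
  also have "(\<Sum>l=1..n. real (nat \<lfloor>real l * x\<rfloor>) / real l) =
     (\<Sum>m=1..M. harm n - harm (nat \<lfloor>real m / x\<rfloor>))"
    unfolding M_def by (rule sum_floor_mult_div[OF x])
  also have "\<dots> = (\<Sum>m=1..M. (harm n + ln x - euler_mascheroni) - ln (real m)
     - harm_error (real m / x) - x / 2 * (saw (real m * (1 / x)) / real m))"
    using x by (intro sum.cong) (auto simp: harm_error_def ln_div)
  also have "\<dots> = real M * (harm n + ln x - euler_mascheroni) - ln (fact M)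
     - (\<Sum>m=1..M. harm_error (real m / x)) - x / 2 * saw_sum M (1 / x)"
    by (simp add: sum.distrib sum_subtractf saw_sum_def sum_distrib_left ln_fact_eq_sum)
  finally show ?thesis by (simp add: algebra_simps)
qed

lemma sum_inverse_squares_le: "(\<Sum>m=1..M. 1 / (real m)\<^sup>2) \<le> 2"
proof (cases "M \<ge> 1")
  case True
  hence "(\<Sum>m=1..M. 1 / (real m)\<^sup>2) \<le> 2 - 1 / real M"
  proof (induction M rule: nat_induct_at_least)
    case (Suc n)
    have "1 / (real (Suc n))\<^sup>2 \<le> 1 / real n - 1 / real (Suc n)"
    proof -
      have "1 / real n - 1 / real (Suc n) = 1 / (real n * real (Suc n))"
        using Suc.hyps by (simp add: field_simps)
      also have "\<dots> \<ge> 1 / (real (Suc n))\<^sup>2"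
        using Suc.hyps by (intro frac_le) (auto simp: power2_eq_square)
      finally show ?thesis .
    qed
    thus ?case using Suc by simp
  qed auto
  also have "\<dots> \<le> 2" by simp
  finally show ?thesis .
qed auto

lemma abs_harm_error_scaled_le:
  assumes "m \<ge> 1" "0 < x" "x < 1"
  shows "\<bar>harm_error (real m / x)\<bar> \<le> 2 * x\<^sup>2 * (1 / (real m)\<^sup>2)"
proof -
  have "real m / x \<ge> 1" using assms by (simp add: field_simps)
  from abs_harm_error_le[OF this] show ?thesis by (simp add: power_divide)
qed

lemma abs_sum_harm_error_le:
  assumes "0 < x" "x < 1"
  shows "\<bar>\<Sum>m=1..M. harm_error (real m / x)\<bar> \<le> 4 * x\<^sup>2"
proof -
  have "\<bar>\<Sum>m=1..M. harm_error (real m / x)\<bar> \<le> (\<Sum>m=1..M. \<bar>harm_error (real m / x)\<bar>)"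
    by (rule sum_abs)
  also have "\<dots> \<le> (\<Sum>m=1..M. 2 * x\<^sup>2 * (1 / (real m)\<^sup>2))"
    using abs_harm_error_scaled_le assms by (intro sum_mono) auto
  also have "\<dots> = 2 * x\<^sup>2 * (\<Sum>m=1..M. 1 / (real m)\<^sup>2)"
    by (simp only: sum_distrib_left)
  also have "\<dots> \<le> 2 * x\<^sup>2 * 2"
    by (intro mult_left_mono sum_inverse_squares_le) auto
  finally show ?thesis by simp
qed

definition recip_sum :: "nat \<Rightarrow> real \<Rightarrow> real" where
  "recip_sum n x = saw_sum n x + x * saw_sum (nat \<lfloor>real n * x\<rfloor>) (1 / x)"

text \<open>Stirling's formula in the shape of \<open>sum_frac_sq_term\<close> is substituted for
  \<open>ln (fact M)\<close>. The large terms are thereby grouped into differences, so that every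
  summand is bounded apart from the first logarithm, and each one has a limit as \<open>n\<close>
  grows.\<close>

lemma recip_sum_expansion:
  fixes x :: real and n :: nat
  assumes x: "x > 0" "x \<notin> \<rat>"
  defines "M \<equiv> nat \<lfloor>real n * x\<rfloor>"
  defines "d \<equiv> (\<lambda>n. harm n - ln (real n) - euler_mascheroni)"
  assumes M: "M \<ge> 1"
  shows "recip_sum n x = ln (real n / real M) + d n - d M - (\<Sum>k<M. frac_sq_term k) + 2 * real M * d n
    + 2 * (real M * ln (real n * x / real M) - (real n * x - real M))
    - 2 * (\<Sum>m=1..M. harm_error (real m / x))"
proof -
  have n: "n > 0" using M by (cases n) (auto simp: M_def)
  have "2 * ln (fact M) = (\<Sum>k<M. frac_sq_term k) + 2 * real M * ln (real M) - 2 * real M + harm M"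
    using sum_frac_sq_term[OF M] by simp
  moreover have "recip_sum n x = harm n - 2 * x * real n + 2 * real M * (harm n + ln x - euler_mascheroni)
      - 2 * ln (fact M) - 2 * (\<Sum>m=1..M. harm_error (real m / x))"
    unfolding recip_sum_def M_def by (rule saw_sum_reciprocity[OF x])
  ultimately show ?thesis
    using n M x by (simp add: d_def ln_div ln_mult algebra_simps)
qed

section \<open>Uniform bound and limit of the reciprocity sums\<close>

lemma harm_asymp_le:
  assumes "n \<ge> 1"
  shows "\<bar>harm n - ln (real n) - euler_mascheroni - 1 / (2 * real n)\<bar> \<le> 2 / (real n)\<^sup>2"
  using abs_harm_error_le[of "real n"] assms by (simp add: harm_error_def saw_def frac_def)

text \<open>With \<open>z = M * (1 + u)\<close> and \<open>0 <= u <= 1 / M\<close>, the expression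
  is \<open>M * (ln (1 + u) - u)\<close>, a Taylor remainder of order
  \<open>M * u^2\<close>.\<close>

lemma ln_ratio_bounds:
  fixes z :: real
  defines "M \<equiv> nat \<lfloor>z\<rfloor>"
  assumes "M \<ge> 1"
  shows "real M * ln (z / real M) - (z - real M) \<le> 0"
        "real M * ln (z / real M) - (z - real M) \<ge> - (1 / real M)"
proof -
  define u where "u = (z - real M) / real M"
  have M: "real M \<le> z" "z \<le> real M + 1" using assms by (auto simp: M_def) linarith+
  have u: "u \<ge> 0" "u \<le> 1 / real M" using M assms(2) by (auto simp: u_def divide_simps)
  have zu: "z / real M = 1 + u" "z - real M = real M * u" using assms(2) by (auto simp: u_def field_simps)
  have "real M * ln (1 + u) \<le> real M * u"
    using ln_add_one_self_le_self[OF u(1)] by (intro mult_left_mono) auto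
  thus "real M * ln (z / real M) - (z - real M) \<le> 0" unfolding zu by simp
  have "real M * ln (1 + u) \<ge> real M * (u - u\<^sup>2 / 2)"
    using ln_one_plus_ge_quadratic[OF u(1)] by (intro mult_left_mono) auto
  moreover have "real M * u\<^sup>2 \<le> real M * (1 / real M)\<^sup>2"
    using u by (intro mult_left_mono power_mono) auto
  moreover have "real M * (1 / real M)\<^sup>2 = 1 / real M"
    using assms(2) by (simp add: power2_eq_square)
  moreover have "0 \<le> 1 / real M" by simp
  moreover have "real M * (u - u\<^sup>2 / 2) = real M * u - real M * u\<^sup>2 / 2" by (simp add: algebra_simps)
  ultimately show "real M * ln (z / real M) - (z - real M) \<ge> - (1 / real M)" unfolding zu by linarith
qed

lemma A_const_nonneg: "A_const \<ge> 0"
  using frac_sq_term_sums frac_sq_term_nonneg by (metis sums_le sums_zero)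

lemma harm_le_one_plus_ln:
  assumes "n \<ge> 1"
  shows "harm n \<le> 1 + ln (real n)"
  using euler_mascheroni_sequence_decreasing[of 1 n] assms by (simp add: harm_def)

text \<open>The point is uniformity in \<open>n\<close>. Each summand of the expansion is bounded
  separately; besides \<open>ln (1 / x)\<close> and \<open>A_const\<close> these bounds add up to at
  most 20, so 30 is a comfortable constant.\<close>

lemma abs_recip_sum_le:
  assumes x: "0 < x" "x < 1" "x \<notin> \<rat>"
  shows "\<bar>recip_sum n x\<bar> \<le> ln (1 / x) + (A_const + 30)"
proof -
  define M where "M = nat \<lfloor>real n * x\<rfloor>"
  have lx: "ln (1 / x) \<ge> 0" using x by simp
  consider "n = 0" | "n \<ge> 1" "M = 0" | "n \<ge> 1" "M \<ge> 1" by linarith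
  thus ?thesis
  proof cases
    case 1
    thus ?thesis using lx A_const_nonneg by (simp add: recip_sum_def saw_sum_def)
  next
    \<comment> \<open>The expansion needs \<open>M >= 1\<close>. Here the sum at
      \<open>1 / x\<close> is empty, and \<open>n < 1 / x\<close> turns the trivial harmonic bound
      into the required logarithm.\<close>
    case 2
    hence nx: "real n * x < 1" unfolding M_def by linarith
    have "recip_sum n x = saw_sum n x"
      using 2 by (simp add: recip_sum_def M_def saw_sum_def)
    moreover have "\<bar>saw_sum n x\<bar> \<le> 1 + ln (real n)"
      using abs_saw_sum_le[of n x] harm_le_one_plus_ln[of n] 2 by simp
    moreover have "ln (real n) \<le> ln (1 / x)"
      using 2 nx x by (subst ln_le_cancel_iff) (auto simp: field_simps)
    ultimately show ?thesis using A_const_nonneg by linarith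
  next
    case 3
    define d where "d = (\<lambda>n. harm n - ln (real n) - euler_mascheroni :: real)"
    have dn: "\<bar>d k\<bar> \<le> 5 / (2 * real k)" if "k \<ge> 1" for k
    proof -
      have "\<bar>d k\<bar> \<le> 1 / (2 * real k) + 2 / (real k)\<^sup>2"
      proof -
        have "0 \<le> 1 / (2 * real k)" by simp
        with harm_asymp_le[OF that] show ?thesis unfolding d_def by linarith
      qed
      also have "2 / (real k)\<^sup>2 \<le> 2 / real k"
        using that by (intro divide_left_mono) (auto simp: power2_eq_square)
      finally show ?thesis using that by (simp add: field_simps)
    qed
    have d5: "\<bar>d k\<bar> \<le> 5 / 2" if "k \<ge> 1" for k
      using dn[OF that] that order_trans[of _ "5 / (2 * real k)" "5 / 2"] by (simp add: field_simps)
    have Mn: "real M \<le> real n * x" "real n * x < real M + 1"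
      using x unfolding M_def by (auto simp: le_nat_iff)
    have Mn': "real M \<le> real n" using Mn mult_left_le[of x "real n"] x by simp
    have "\<bar>2 * real M * d n\<bar> \<le> 2 * real n * (5 / (2 * real n))"
      unfolding abs_mult using dn[OF 3(1)] Mn' by (intro mult_mono) auto
    hence b1: "\<bar>2 * real M * d n\<bar> \<le> 5" using 3 by simp
    have P: "0 \<le> (\<Sum>k<M. frac_sq_term k)" "(\<Sum>k<M. frac_sq_term k) \<le> A_const"
      using sum_le_suminf[of frac_sq_term "{..<M}"] frac_sq_term_sums frac_sq_term_nonneg
      by (auto simp: sums_iff sum_nonneg)
    have l0: "ln (real n / real M) \<ge> 0" using Mn' 3 by simp
    have "real n * x \<le> 2 * real M" using Mn 3 by linarith
    hence "ln (real n / real M) \<le> ln (2 * (1 / x))"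
      using 3 x by (subst ln_le_cancel_iff) (auto simp: field_simps)
    also have "\<dots> = ln 2 + ln (1 / x)" using x by (subst ln_mult) auto
    finally have l1: "ln (real n / real M) \<le> 1 + ln (1 / x)" using ln_2_less_1 by simp
    have r: "\<bar>\<Sum>m=1..M. harm_error (real m / x)\<bar> \<le> 4"
      using abs_sum_harm_error_le[of x M] x power_le_one[of x 2] by simp
    have q: "1 / real M \<le> 1" using 3 by simp
    have e: "recip_sum n x = ln (real n / real M) + d n - d M - (\<Sum>k<M. frac_sq_term k) + 2 * real M * d n
      + 2 * (real M * ln (real n * x / real M) - (real n * x - real M))
      - 2 * (\<Sum>m=1..M. harm_error (real m / x))"
      unfolding d_def M_def by (rule recip_sum_expansion) (use x 3 in \<open>auto simp: M_def\<close>)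
    have Q: "real M * ln (real n * x / real M) - (real n * x - real M) \<le> 0"
      "real M * ln (real n * x / real M) - (real n * x - real M) \<ge> - 1"
      using ln_ratio_bounds[of "real n * x", folded M_def, OF 3(2)] q by linarith+
    have sum_bounds: "L + d1 - d2 - P + W + 2 * Q - 2 * R \<le> l + (A + 30)"
      "- (L + d1 - d2 - P + W + 2 * Q - 2 * R) \<le> l + (A + 30)"
      if "0 \<le> L" "L \<le> 1 + l" "0 \<le> P" "P \<le> A" "\<bar>W\<bar> \<le> 5" "\<bar>R\<bar> \<le> 4" "\<bar>d1\<bar> \<le> 5 / 2" "\<bar>d2\<bar> \<le> 5 / 2"
        "Q \<le> 0" "Q \<ge> - 1" for L l d1 d2 P W Q R A :: real
      using that by linarith+
    have "recip_sum n x \<le> ln (1 / x) + (A_const + 30)"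
      unfolding e by (rule sum_bounds(1)[OF l0 l1 P b1 r d5[OF 3(1)] d5[OF 3(2)] Q])
    moreover have "- recip_sum n x \<le> ln (1 / x) + (A_const + 30)"
      unfolding e by (rule sum_bounds(2)[OF l0 l1 P b1 r d5[OF 3(1)] d5[OF 3(2)] Q])
    ultimately show ?thesis by (rule abs_leI)
  qed
qed

lemma tendsto_nat_floor_div:
  assumes "x > 0"
  shows "(\<lambda>n. real (nat \<lfloor>real n * x\<rfloor>) / real n) \<longlonglongrightarrow> x"
proof (rule tendsto_sandwich)
  show "(\<lambda>n. x - 1 / real n) \<longlonglongrightarrow> x" by real_asymp
  show "(\<lambda>n. x) \<longlonglongrightarrow> x" by simp
  show "\<forall>\<^sub>F n in sequentially. x - 1 / real n \<le> real (nat \<lfloor>real n * x\<rfloor>) / real n"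
    using eventually_gt_at_top[of 0]
  proof eventually_elim
    case (elim n)
    have "x - 1 / real n = (real n * x - 1) / real n" using elim by (simp add: diff_divide_distrib)
    also have "\<dots> \<le> real (nat \<lfloor>real n * x\<rfloor>) / real n"
      by (intro divide_right_mono) (auto, linarith)
    finally show ?case .
  qed
  show "\<forall>\<^sub>F n in sequentially. real (nat \<lfloor>real n * x\<rfloor>) / real n \<le> x"
    using eventually_gt_at_top[of 0]
  proof eventually_elim
    case (elim n)
    have "real (nat \<lfloor>real n * x\<rfloor>) \<le> real n * x" using assms by simp
    thus ?case using elim by (simp add: field_simps)
  qed
qed

lemma filterlim_nat_floor_mult:
  fixes x :: real
  assumes "x > 0"
  shows "filterlim (\<lambda>n. nat \<lfloor>real n * x\<rfloor>) at_top sequentially"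
proof -
  have "filterlim (\<lambda>n. real n * x) at_top sequentially" using assms by real_asymp
  thus ?thesis
    by (intro filterlim_compose[OF filterlim_nat_sequentially] filterlim_compose[OF filterlim_floor_sequentially])
qed

text \<open>The limit is \<open>ln (1 / x) - A_const + x - 2 * R\<close>, where \<open>R\<close> is
  the full series of harmonic errors and \<open>\<bar>R\<bar> <= 4 * x^2 <= 4 * x\<close>; hence the
  factor 9.\<close>

lemma recip_sum_tendsto:
  assumes x: "0 < x" "x < 1" "x \<notin> \<rat>"
  obtains F where "(\<lambda>n. recip_sum n x) \<longlonglongrightarrow> F" "\<bar>F - (ln (1 / x) - A_const)\<bar> \<le> 9 * x"
proof -
  define M where "M = (\<lambda>n. nat \<lfloor>real n * x\<rfloor>)"
  define d where "d = (\<lambda>n. harm n - ln (real n) - euler_mascheroni :: real)"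
  define r where "r = (\<lambda>k. \<Sum>m=1..k. harm_error (real m / x))"
  have Mtop: "filterlim M at_top sequentially"
    unfolding M_def using x by (intro filterlim_nat_floor_mult) auto
  have Mn: "(\<lambda>n. real (M n) / real n) \<longlonglongrightarrow> x"
    unfolding M_def using x by (intro tendsto_nat_floor_div) auto
  have d0: "d \<longlonglongrightarrow> 0"
    using tendsto_diff[OF euler_mascheroni_LIMSEQ tendsto_const[of euler_mascheroni]] by (simp add: d_def)
  \<comment> \<open>The summand \<open>2 * M * d n\<close> is a growing factor times a vanishing
    one. Written as \<open>2 * (M / n) * (n * d n)\<close> it tends to \<open>2 * x * (1/2)\<close>,
    the term \<open>x\<close> of the limit.\<close>
  have nd: "(\<lambda>n. real n * d n) \<longlonglongrightarrow> 1 / 2"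
  proof (rule LIM_zero_cancel, rule Lim_null_comparison)
    show "(\<lambda>n. 2 / real n) \<longlonglongrightarrow> 0" by real_asymp
    show "\<forall>\<^sub>F n in sequentially. norm (real n * d n - 1 / 2) \<le> 2 / real n"
      using eventually_gt_at_top[of 0]
    proof eventually_elim
      case (elim n)
      have "real n * d n - 1 / 2 = real n * (d n - 1 / (2 * real n))"
        using elim by (simp add: right_diff_distrib)
      hence "\<bar>real n * d n - 1 / 2\<bar> = real n * \<bar>d n - 1 / (2 * real n)\<bar>"
        by (simp add: abs_mult)
      also have "\<dots> \<le> real n * (2 / (real n)\<^sup>2)"
        using harm_asymp_le[of n] elim by (intro mult_left_mono) (auto simp: d_def)
      finally show ?case using elim by (simp add: power2_eq_square)
    qed
  qed
  have lnM: "(\<lambda>n. ln (real n / real (M n))) \<longlonglongrightarrow> ln (1 / x)"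
  proof -
    have "(\<lambda>n. ln (inverse (real (M n) / real n))) \<longlonglongrightarrow> ln (inverse x)"
      using x by (intro tendsto_ln tendsto_inverse Mn) auto
    thus ?thesis by (simp add: inverse_eq_divide)
  qed
  have PM: "(\<lambda>n. \<Sum>k<M n. frac_sq_term k) \<longlonglongrightarrow> A_const"
    using frac_sq_term_sums unfolding sums_def by (rule filterlim_compose) (rule Mtop)
  have Mev: "\<forall>\<^sub>F n in sequentially. M n \<ge> 1 \<and> n \<ge> 1"
    using Mtop unfolding filterlim_at_top by (intro eventually_conj) (auto intro: eventually_ge_at_top)
  have br: "(\<lambda>n. real (M n) * ln (real n * x / real (M n)) - (real n * x - real (M n))) \<longlonglongrightarrow> 0"
  proof (rule tendsto_sandwich)
    have "(\<lambda>n. - (1 / real n)) \<longlonglongrightarrow> 0" by real_asymp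
    thus "(\<lambda>n. - (1 / real (M n))) \<longlonglongrightarrow> 0" by (rule filterlim_compose) (rule Mtop)
    show "(\<lambda>n. 0 :: real) \<longlonglongrightarrow> 0" by simp
  qed (use Mev in eventually_elim, use ln_ratio_bounds in \<open>auto simp: M_def\<close>)+
  have "summable (\<lambda>m. harm_error (real (Suc m) / x))"
  proof (rule summable_comparison_test')
    have "summable (\<lambda>n. 1 / (real (Suc n))\<^sup>2)"
      using inverse_squares_sums by (auto simp: sums_iff add_ac)
    thus "summable (\<lambda>n. 2 * x\<^sup>2 * (1 / (real (Suc n))\<^sup>2))" by (rule summable_mult)
    show "norm (harm_error (real (Suc n) / x)) \<le> 2 * x\<^sup>2 * (1 / (real (Suc n))\<^sup>2)" for n
      using abs_harm_error_scaled_le[of "Suc n" x] x by simp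
  qed
  then obtain R where "(\<lambda>m. harm_error (real (Suc m) / x)) sums R" by (auto simp: summable_def)
  moreover have "(\<Sum>m<k. harm_error (real (Suc m) / x)) = r k" for k
    unfolding r_def by (rule sum.reindex_bij_witness[of _ "\<lambda>l. l - 1" Suc]) auto
  ultimately have rR: "r \<longlonglongrightarrow> R" by (simp add: sums_def)
  have "\<bar>R\<bar> \<le> 4 * x\<^sup>2"
    by (rule LIMSEQ_le_const2[OF tendsto_rabs[OF rR]])
       (use abs_sum_harm_error_le x in \<open>auto simp: r_def\<close>)
  have "(\<lambda>n. ln (real n / real (M n)) + d n - d (M n) - (\<Sum>k<M n. frac_sq_term k)
      + 2 * (real (M n) / real n) * (real n * d n)
      + 2 * (real (M n) * ln (real n * x / real (M n)) - (real n * x - real (M n))) - 2 * r (M n))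
     \<longlonglongrightarrow> ln (1 / x) + 0 - 0 - A_const + 2 * x * (1 / 2) + 2 * 0 - 2 * R"
    by (intro tendsto_intros lnM d0 PM Mn nd br filterlim_compose[OF d0 Mtop] filterlim_compose[OF rR Mtop])
  moreover have "\<forall>\<^sub>F n in sequentially. ln (real n / real (M n)) + d n - d (M n) - (\<Sum>k<M n. frac_sq_term k)
      + 2 * (real (M n) / real n) * (real n * d n)
      + 2 * (real (M n) * ln (real n * x / real (M n)) - (real n * x - real (M n))) - 2 * r (M n)
      = recip_sum n x"
    using Mev
  proof eventually_elim
    case (elim n)
    show ?case
      using recip_sum_expansion[of x n] x elim by (simp add: M_def d_def r_def)
  qed
  ultimately have "(\<lambda>n. recip_sum n x) \<longlonglongrightarrow> ln (1 / x) - A_const + x - 2 * R"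
    by (simp add: Lim_transform_eventually)
  moreover have "\<bar>(ln (1 / x) - A_const + x - 2 * R) - (ln (1 / x) - A_const)\<bar> \<le> 9 * x"
  proof -
    have "x\<^sup>2 \<le> x" using x by (simp add: power2_eq_square mult_left_le)
    thus ?thesis using \<open>\<bar>R\<bar> \<le> 4 * x\<^sup>2\<close> x by linarith
  qed
  ultimately show ?thesis by (rule that)
qed

section \<open>The inversion x to 1/x on integrals of periodic functions\<close>

lemma AE_lborel_irrational: "AE x in lborel. (x :: real) \<notin> \<rat>"
  by (rule AE_not_in) (intro countable_imp_null_set_lborel countable_rat)

lemma nn_integral_reciprocal_piece:
  fixes f :: "real \<Rightarrow> ennreal"
  assumes [measurable]: "f \<in> borel_measurable borel"
    and per: "\<And>t k. f (t + of_int k) = f t"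
    and n: "n \<ge> (1::nat)"
  shows "(\<integral>\<^sup>+x. f (1 / x) * ennreal (1 / x\<^sup>2) * indicator {1 / (real n + 1)..1 / real n} x \<partial>lborel)
         = (\<integral>\<^sup>+x\<in>{0..1}. f x \<partial>lborel)"
proof -
  have pos: "x > 0" if "x \<in> {1 / (real n + 1)..1 / real n}" for x
    using that by (auto intro: less_le_trans[rotated])
  \<comment> \<open>The substitution uses the increasing map \<open>- 1 / x\<close>, whose
    derivative is nonnegative; the reflection that follows undoes the sign and, by periodicity,
    shifts \<open>[n, n + 1]\<close> to the unit interval.\<close>
  have "(\<integral>\<^sup>+x. f (- x) * indicator {- 1 / (1 / (real n + 1))..- 1 / (1 / real n)} x \<partial>lborel)
    = (\<integral>\<^sup>+x. f (- (- 1 / x)) * ennreal (1 / x\<^sup>2) * indicator {1 / (real n + 1)..1 / real n} x \<partial>lborel)"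
  proof (rule nn_integral_substitution_aux[where f = "\<lambda>x. f (- x)"])
    show "((\<lambda>x. - 1 / x) has_real_derivative 1 / x\<^sup>2) (at x)"
      if "x \<in> {1 / (real n + 1)..1 / real n}" for x
      using pos[OF that] by (auto intro!: derivative_eq_intros simp: power2_eq_square)
    show "continuous_on {1 / (real n + 1)..1 / real n} (\<lambda>x. 1 / x\<^sup>2)"
      using pos by (intro continuous_intros) force
    show "1 / (real n + 1) < 1 / real n" using n by (simp add: field_simps)
  qed auto
  moreover have "(\<integral>\<^sup>+x. f (- x) * indicator {- 1 / (1 / (real n + 1))..- 1 / (1 / real n)} x \<partial>lborel)
      = (\<integral>\<^sup>+x. f (- (- real n + (-1) * x)) * indicator {- real n - 1..- real n} (- real n + (-1) * x) \<partial>lborel)"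
    by (subst nn_integral_real_affine[where c = "-1" and t = "- real n"]) auto
  moreover have "\<dots> = (\<integral>\<^sup>+x\<in>{0..1}. f x \<partial>lborel)"
  proof (rule nn_integral_cong)
    fix x :: real
    have "f (- (- real n + (-1) * x)) = f x" using per[of x "int n"] by (simp add: add_ac)
    thus "f (- (- real n + (-1) * x)) * indicator {- real n - 1..- real n} (- real n + (-1) * x)
       = f x * indicator {0..1} x" by (auto simp: indicator_def)
  qed
  ultimately show ?thesis by simp
qed

lemma summable_shift_powr:
  fixes s :: real
  assumes "s < 1"
  shows "summable (\<lambda>n. (real n + 2) powr (s - 2))"
proof -
  have "summable (\<lambda>n. real (n + 2) powr (s - 2))"
    using assms by (subst summable_iff_shift) (simp add: summable_real_powr_iff)
  thus ?thesis by (simp add: add_ac)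
qed

text \<open>Inversion carries each interval between consecutive reciprocals of integers to a full
  period. Since \<open>x powr (- s) = (1 / x) powr (s - 2) * (1 / x^2)\<close>, the weight left
  after the change of variables is at most \<open>n powr (s - 2)\<close> on the \<open>n\<close>-th
  piece, which is summable for \<open>s < 1\<close>.\<close>

lemma nn_integral_reciprocal_le:
  fixes f :: "real \<Rightarrow> ennreal" and s :: real
  assumes [measurable]: "f \<in> borel_measurable borel"
    and per: "\<And>t k. f (t + of_int k) = f t"
    and s: "s < 1"
  shows "(\<integral>\<^sup>+x\<in>{0<..<1/2}. ennreal (x powr (- s)) * f (1 / x) \<partial>lborel)
         \<le> ennreal (\<Sum>n. (real n + 2) powr (s - 2)) * (\<integral>\<^sup>+x\<in>{0..1}. f x \<partial>lborel)"
proof -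
  define h where "h = (\<lambda>n x. ennreal ((real n + 2) powr (s - 2)) *
    (f (1 / x) * ennreal (1 / x\<^sup>2) * indicator {1 / (real (n + 2) + 1)..1 / real (n + 2)} x))"
  have "(\<integral>\<^sup>+x\<in>{0<..<1/2}. ennreal (x powr (- s)) * f (1 / x) \<partial>lborel) \<le> (\<integral>\<^sup>+x. (\<Sum>n. h n x) \<partial>lborel)"
  proof (rule nn_integral_mono)
    fix x :: real
    show "ennreal (x powr (- s)) * f (1 / x) * indicator {0<..<1/2} x \<le> (\<Sum>n. h n x)"
    proof (cases "x \<in> {0<..<1/2}")
      case True
      \<comment> \<open>The offset 2 is available because \<open>1 / x > 2\<close> on the
        interval.\<close>
      define n where "n = nat \<lfloor>1 / x\<rfloor> - 2"
      have "1 / x > 2" using True by (simp add: field_simps)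
      hence n2: "real n + 2 = of_int \<lfloor>1 / x\<rfloor>" unfolding n_def by linarith
      hence nx: "real n + 2 \<le> 1 / x" "1 / x \<le> real n + 3" by linarith+
      have x: "0 < x" using True by simp
      have mem: "x \<in> {1 / (real (n + 2) + 1)..1 / real (n + 2)}"
        using nx x by (auto simp: field_simps)
      have "x powr (- s) = (1 / x) powr (s - 2) * (1 / x\<^sup>2)"
        using x by (simp add: powr_divide powr_diff powr_minus field_simps)
      also have "\<dots> \<le> (real n + 2) powr (s - 2) * (1 / x\<^sup>2)"
        using nx s by (intro mult_right_mono powr_mono2') auto
      finally have le: "x powr (- s) \<le> (real n + 2) powr (s - 2) * (1 / x\<^sup>2)" .
      have "ennreal (x powr (- s)) * f (1 / x) * indicator {0<..<1/2} x = ennreal (x powr (- s)) * f (1 / x)"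
        using True by simp
      also have "\<dots> \<le> ennreal ((real n + 2) powr (s - 2) * (1 / x\<^sup>2)) * f (1 / x)"
        using le by (intro mult_right_mono ennreal_leI) auto
      also have "\<dots> = h n x"
        using mem unfolding h_def by (subst ennreal_mult) (auto simp: mult_ac)
      also have "\<dots> \<le> (\<Sum>n. h n x)"
        using sum_le_suminf[of "\<lambda>n. h n x" "{n}"] by simp
      finally show ?thesis .
    qed auto
  qed
  also have "\<dots> = (\<Sum>n. \<integral>\<^sup>+x. h n x \<partial>lborel)"
    unfolding h_def by (intro nn_integral_suminf) measurable
  also have "\<dots> = (\<Sum>n. ennreal ((real n + 2) powr (s - 2)) * (\<integral>\<^sup>+x\<in>{0..1}. f x \<partial>lborel))"
  proof (rule suminf_cong)
    fix n
    show "(\<integral>\<^sup>+x. h n x \<partial>lborel) = ennreal ((real n + 2) powr (s - 2)) * (\<integral>\<^sup>+x\<in>{0..1}. f x \<partial>lborel)"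
      unfolding h_def
      by (subst nn_integral_cmult, measurable, subst nn_integral_reciprocal_piece) (use per in auto)
  qed
  also have "\<dots> = (\<Sum>n. ennreal ((real n + 2) powr (s - 2))) * (\<integral>\<^sup>+x\<in>{0..1}. f x \<partial>lborel)"
    by simp
  also have "(\<Sum>n. ennreal ((real n + 2) powr (s - 2))) = ennreal (\<Sum>n. (real n + 2) powr (s - 2))"
    using summable_shift_powr[OF s] by (intro suminf_ennreal2) auto
  finally show ?thesis .
qed

text \<open>The map \<open>x -> 1 - x\<close> exchanges the two halves of the interval; the points
  0, 1/2 and 1 form a null set.\<close>

lemma nn_integral_unit_interval_even_periodic:
  fixes f :: "real \<Rightarrow> ennreal"
  assumes [measurable]: "f \<in> borel_measurable borel"
    and per: "\<And>t k. f (t + of_int k) = f t"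
    and even: "AE t in lborel. t \<in> {0<..<1/2} \<longrightarrow> f (- t) = f t"
  shows "(\<integral>\<^sup>+x\<in>{0..1}. f x \<partial>lborel) = 2 * (\<integral>\<^sup>+x\<in>{0<..<1/2}. f x \<partial>lborel)"
proof -
  have "(\<integral>\<^sup>+x\<in>{0..1}. f x \<partial>lborel)
    = (\<integral>\<^sup>+x. f x * indicator {0<..<1/2} x + f x * indicator {1/2<..<1} x \<partial>lborel)"
  proof (rule nn_integral_cong_AE, use AE_lborel_irrational in eventually_elim)
    case (elim x)
    have "(0::real) \<in> \<rat>" "(1::real) \<in> \<rat>" "(1 / 2 :: real) \<in> \<rat>" by (simp_all add: Rats_divide)
    hence "x \<noteq> 0" "x \<noteq> 1" "x \<noteq> 1 / 2" using elim by metis+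
    thus ?case by (auto simp: indicator_def)
  qed
  also have "\<dots> = (\<integral>\<^sup>+x\<in>{0<..<1/2}. f x \<partial>lborel) + (\<integral>\<^sup>+x\<in>{1/2<..<1}. f x \<partial>lborel)"
    by (intro nn_integral_add) auto
  also have "(\<integral>\<^sup>+x\<in>{1/2<..<1}. f x \<partial>lborel)
     = (\<integral>\<^sup>+x. f (1 + (-1) * x) * indicator {1/2<..<1} (1 + (-1) * x) \<partial>lborel)"
    by (subst nn_integral_real_affine[where c = "-1" and t = 1]) auto
  also have "\<dots> = (\<integral>\<^sup>+x\<in>{0<..<1/2}. f x \<partial>lborel)"
  proof (rule nn_integral_cong_AE, use even in eventually_elim)
    case (elim x)
    have "f (1 + (-1) * x) = f (- x)" using per[of "- x" 1] by simp
    thus ?case using elim by (auto simp: indicator_def)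
  qed
  finally show ?thesis by (simp add: mult_2)
qed

text \<open>A bound below 1 is what makes the oscillation argument a contraction. It comes from the
  telescoping majorant \<open>1 / ((n + 3/2) * (n + 5/2))\<close>.\<close>

lemma suminf_inverse_squares_shift_le: "(\<Sum>n. (real n + 2) powr (0 - 2)) \<le> 2 / 3"
proof -
  have "(\<lambda>n. 1 / (real n + 3/2)) \<longlonglongrightarrow> 0" by real_asymp
  from telescope_sums'[OF this]
  have t: "(\<lambda>n. 1 / (real n + 3/2) - 1 / (real (Suc n) + 3/2)) sums (2 / 3)" by simp
  have "(real n + 2) powr (0 - 2) \<le> 1 / (real n + 3/2) - 1 / (real (Suc n) + 3/2)" for n
  proof -
    have "(real n + 2) powr (0 - 2) = 1 / ((real n + 2) * (real n + 2))"
      by (simp add: powr_minus power2_eq_square field_simps)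
    also have "\<dots> \<le> 1 / ((real n + 3/2) * (real n + 5/2))"
      by (intro frac_le mult_pos_pos) (auto simp: algebra_simps)
    also have "\<dots> = 1 / (real n + 3/2) - 1 / (real (Suc n) + 3/2)"
      by (simp add: divide_simps)
    finally show ?thesis .
  qed
  hence "(\<Sum>n. (real n + 2) powr (0 - 2)) \<le> (\<Sum>n. 1 / (real n + 3/2) - 1 / (real (Suc n) + 3/2))"
    using t summable_shift_powr[of 0] by (intro suminf_le) (auto simp: sums_iff)
  thus ?thesis using t by (simp add: sums_iff)
qed

section \<open>Exponential integrability and almost everywhere convergence\<close>

text \<open>The exponent is a parameter because passing from \<open>x < 1/2\<close> to
  \<open>1 / x\<close> lowers it from 3/4 to 3/8.\<close>

definition exp_saw_max :: "real \<Rightarrow> nat \<Rightarrow> real \<Rightarrow> ennreal" where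
  "exp_saw_max a n x = (SUP k\<in>{..n}. ennreal (exp (a * \<bar>saw_sum k x\<bar>)))"

lemma exp_saw_max_measurable [measurable]: "exp_saw_max a n \<in> borel_measurable borel"
  unfolding exp_saw_max_def by measurable

lemma exp_saw_max_add_of_int: "exp_saw_max a n (x + of_int k) = exp_saw_max a n x"
  by (simp add: exp_saw_max_def saw_sum_add_of_int)

lemma exp_saw_max_minus: "x \<notin> \<rat> \<Longrightarrow> exp_saw_max a n (- x) = exp_saw_max a n x"
  by (simp add: exp_saw_max_def saw_sum_minus)

text \<open>By reciprocity \<open>\<bar>saw_sum k x\<bar>\<close> is at most
  \<open>ln (1 / x)\<close> plus a constant plus half of the absolute value of a sum at
  \<open>1 / x\<close>, whose length \<open>j\<close> does not exceed \<open>k\<close>.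
  Exponentiation makes the logarithm the integrable weight \<open>x powr (- (3/4))\<close>.\<close>

lemma exp_saw_max_recursion:
  assumes x: "0 < x" "x < 1/2" "x \<notin> \<rat>"
  shows "exp_saw_max (3/4) n x
    \<le> ennreal (exp (3/4 * (A_const + 30))) * (ennreal (x powr (- (3/4))) * exp_saw_max (3/8) n (1 / x))"
  unfolding exp_saw_max_def[of "3/4"]
proof (rule SUP_least)
  fix k assume k: "k \<in> {..n}"
  define j where "j = nat \<lfloor>real k * x\<rfloor>"
  have "real j \<le> real k * x" unfolding j_def using x by simp
  also have "\<dots> \<le> real k" using x by (simp add: mult_left_le)
  finally have j: "j \<in> {..n}" using k by simp
  have "saw_sum k x = recip_sum k x - x * saw_sum j (1 / x)"
    by (simp add: recip_sum_def j_def)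
  hence "\<bar>saw_sum k x\<bar> \<le> \<bar>recip_sum k x\<bar> + x * \<bar>saw_sum j (1 / x)\<bar>"
    using x abs_triangle_ineq4[of "recip_sum k x" "x * saw_sum j (1 / x)"] by (simp add: abs_mult)
  also have "\<dots> \<le> (ln (1 / x) + (A_const + 30)) + 1/2 * \<bar>saw_sum j (1 / x)\<bar>"
    using x by (intro add_mono abs_recip_sum_le mult_right_mono) auto
  finally have "exp (3/4 * \<bar>saw_sum k x\<bar>) \<le>
      exp (3/4 * ((ln (1 / x) + (A_const + 30)) + 1/2 * \<bar>saw_sum j (1 / x)\<bar>))"
    by simp
  also have "\<dots> = exp (3/4 * (A_const + 30)) * (x powr (- (3/4)) * exp (3/8 * \<bar>saw_sum j (1 / x)\<bar>))"
    using x by (simp add: powr_def ln_div algebra_simps flip: exp_add)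
  finally have "ennreal (exp (3/4 * \<bar>saw_sum k x\<bar>)) \<le> ennreal (exp (3/4 * (A_const + 30))) *
      (ennreal (x powr (- (3/4))) * ennreal (exp (3/8 * \<bar>saw_sum j (1 / x)\<bar>)))"
    by (simp add: ennreal_leI flip: ennreal_mult)
  also have "\<dots> \<le> ennreal (exp (3/4 * (A_const + 30))) *
      (ennreal (x powr (- (3/4))) * exp_saw_max (3/8) n (1 / x))"
    unfolding exp_saw_max_def using j by (intro mult_left_mono SUP_upper) auto
  finally show "ennreal (exp (3/4 * \<bar>saw_sum k x\<bar>)) \<le> \<dots>" .
qed

text \<open>
  Together with the recursion this bounds the integral of the maximum by half of itself plus a
  constant; the maximum over finitely many \<open>k\<close> makes that integral finite to begin with.
\<close>
lemma exp_saw_max_half_le: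
  assumes e: "e > 0"
  shows "exp_saw_max (3/8) n x \<le> ennreal e * exp_saw_max (3/4) n x + ennreal (1 / e)"
  unfolding exp_saw_max_def[of "3/8"]
proof (rule SUP_least)
  fix k assume k: "k \<in> {..n}"
  define y where "y = exp (3/8 * \<bar>saw_sum k x\<bar>)"
  have yy: "exp (3/4 * \<bar>saw_sum k x\<bar>) = y * y" by (simp add: y_def flip: exp_add)
  \<comment> \<open>A nonnegative quantity whose expansion bounds \<open>y\<close> by a small
    multiple of \<open>y * y\<close> plus a constant; \<open>y * y\<close> is the exponential at
    3/4.\<close>
  have "0 \<le> (e * y - 1)\<^sup>2 + e * y" using e by (simp add: y_def)
  hence "y * e \<le> e * e * (y * y) + 1" by (simp add: power2_eq_square algebra_simps)
  hence "y \<le> e * (y * y) + 1 / e" using e by (simp add: field_simps)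
  hence "ennreal y \<le> ennreal e * ennreal (exp (3/4 * \<bar>saw_sum k x\<bar>)) + ennreal (1 / e)"
    unfolding yy using e by (simp add: ennreal_leI flip: ennreal_mult ennreal_plus)
  also have "\<dots> \<le> ennreal e * exp_saw_max (3/4) n x + ennreal (1 / e)"
    unfolding exp_saw_max_def using k by (intro add_right_mono mult_left_mono SUP_upper) auto
  finally show "ennreal (exp (3/8 * \<bar>saw_sum k x\<bar>)) \<le> \<dots>" by (simp add: y_def)
qed

lemma nn_integral_exp_saw_max_bounded:
  obtains D :: real where "D \<ge> 0" "\<And>n. (\<integral>\<^sup>+x\<in>{0..1}. exp_saw_max (3/4) n x \<partial>lborel) \<le> ennreal D"
proof -
  define c where "c = exp (3/4 * (A_const + 30))"
  define Z where "Z = (\<Sum>n. (real n + 2) powr (3/4 - 2))"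
  have "(2::real) powr (3/4 - 2) \<le> Z"
    unfolding Z_def using sum_le_suminf[of "\<lambda>n. (real n + 2) powr (3/4 - 2)" "{0}"]
      summable_shift_powr[of "3/4"] by simp
  hence Z: "Z > 0" by (smt (verit) powr_gt_zero)
  have c: "c > 0" by (simp add: c_def)
  \<comment> \<open>Chosen so that the factor \<open>2 * c * Z * e\<close> in front of the integral
    on the right becomes 1/2; \<open>D\<close> is then twice the remaining constant.\<close>
  define e where "e = 1 / (4 * c * Z)"
  have e: "e > 0" using c Z by (simp add: e_def)
  define D where "D = 2 * (2 * c * Z * (1 / e))"
  show ?thesis
  proof
    show "D \<ge> 0" using c Z e by (simp add: D_def)
    fix n
    define I where "I = (\<integral>\<^sup>+x\<in>{0..1}. exp_saw_max (3/4) n x \<partial>lborel)"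
    \<comment> \<open>A bound depending on \<open>n\<close>, used only to know that the integral is
      finite and can be subtracted from both sides.\<close>
    have "exp_saw_max (3/4) n x \<le> ennreal (exp (3/4 * harm n))" for x
      unfolding exp_saw_max_def
    proof (rule SUP_least)
      fix k assume "k \<in> {..n}"
      hence "\<bar>saw_sum k x\<bar> \<le> harm n"
        using abs_saw_sum_le[of k x] harm_mono[of k n, where 'a = real] by simp
      thus "ennreal (exp (3/4 * \<bar>saw_sum k x\<bar>)) \<le> ennreal (exp (3/4 * harm n))"
        by (intro ennreal_leI) simp
    qed
    hence "I \<le> (\<integral>\<^sup>+x\<in>{0..1::real}. ennreal (exp (3/4 * harm n)) \<partial>lborel)"
      unfolding I_def by (intro nn_integral_mono mult_right_mono) auto
    also have "\<dots> = ennreal (exp (3/4 * harm n))"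
      by (subst nn_integral_cmult_indicator) auto
    finally have "I < top" using ennreal_less_top le_less_trans by blast
    then obtain r where r: "I = ennreal r" "r \<ge> 0" by (cases I) auto
    have "I = 2 * (\<integral>\<^sup>+x\<in>{0<..<1/2}. exp_saw_max (3/4) n x \<partial>lborel)"
      unfolding I_def
      by (rule nn_integral_unit_interval_even_periodic)
         (use AE_lborel_irrational in \<open>auto simp: exp_saw_max_add_of_int exp_saw_max_minus\<close>)
    also have "\<dots> \<le> 2 * (\<integral>\<^sup>+x. ennreal c *
        ((ennreal (x powr (- (3/4))) * exp_saw_max (3/8) n (1 / x)) * indicator {0<..<1/2} x) \<partial>lborel)"
    proof (intro mult_left_mono nn_integral_mono_AE)
      show "AE x in lborel. exp_saw_max (3/4) n x * indicator {0<..<1/2} x \<le> ennreal c *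
        ((ennreal (x powr (- (3/4))) * exp_saw_max (3/8) n (1 / x)) * indicator {0<..<1/2} x)"
        using AE_lborel_irrational
      proof eventually_elim
        case (elim x)
        thus ?case using exp_saw_max_recursion[of x n] by (auto simp: indicator_def c_def)
      qed
    qed auto
    also have "\<dots> = 2 * (ennreal c *
        (\<integral>\<^sup>+x\<in>{0<..<1/2}. ennreal (x powr (- (3/4))) * exp_saw_max (3/8) n (1 / x) \<partial>lborel))"
      by (subst nn_integral_cmult) auto
    also have "\<dots> \<le> 2 * (ennreal c * (ennreal Z * (\<integral>\<^sup>+x\<in>{0..1}. exp_saw_max (3/8) n x \<partial>lborel)))"
      unfolding Z_def
      by (intro mult_left_mono nn_integral_reciprocal_le) (auto simp: exp_saw_max_add_of_int)
    also have "(\<integral>\<^sup>+x\<in>{0..1}. exp_saw_max (3/8) n x \<partial>lborel)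
       \<le> (\<integral>\<^sup>+x. ennreal e * (exp_saw_max (3/4) n x * indicator {0..1} x)
             + ennreal (1 / e) * indicator {0..1} x \<partial>lborel)"
      using exp_saw_max_half_le[OF e]
      by (intro nn_integral_mono) (auto simp: indicator_def)
    also have "\<dots> = ennreal e * I + ennreal (1 / e)"
      unfolding I_def by (subst nn_integral_add) (auto simp: nn_integral_cmult nn_integral_cmult_indicator)
    finally have "ennreal r \<le> 2 * (ennreal c * (ennreal Z * (ennreal e * ennreal r + ennreal (1 / e))))"
      unfolding r(1) by (simp add: mult_left_mono)
    also have "\<dots> = ennreal (2 * (c * (Z * (e * r + 1 / e))))"
      using c Z e r(2) by (simp add: ennreal_mult ennreal_plus)
    finally have "r \<le> 2 * (c * (Z * (e * r + 1 / e)))"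
      using c Z e r(2) by (subst (asm) ennreal_le_iff) auto
    also have "\<dots> = r / 2 + D / 2"
      using c Z by (simp add: e_def D_def field_simps)
    finally show "(\<integral>\<^sup>+x\<in>{0..1}. exp_saw_max (3/4) n x \<partial>lborel) \<le> ennreal D"
      unfolding I_def[symmetric] r(1) by (intro ennreal_leI) simp
  qed
qed

definition exp_saw_sup :: "real \<Rightarrow> ennreal" where
  "exp_saw_sup x = (SUP n. exp_saw_max (3/4) n x)"

lemma exp_saw_sup_measurable [measurable]: "exp_saw_sup \<in> borel_measurable borel"
  unfolding exp_saw_sup_def by measurable

lemma exp_saw_sup_upper: "ennreal (exp (3/4 * \<bar>saw_sum n x\<bar>)) \<le> exp_saw_sup x"
  unfolding exp_saw_sup_def exp_saw_max_def
  by (rule SUP_upper2[of n]) (auto intro: SUP_upper)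

lemma nn_integral_exp_saw_sup_finite: "(\<integral>\<^sup>+x\<in>{0..1}. exp_saw_sup x \<partial>lborel) < top"
proof -
  obtain D where D: "D \<ge> 0" "\<And>n. (\<integral>\<^sup>+x\<in>{0..1}. exp_saw_max (3/4) n x \<partial>lborel) \<le> ennreal D"
    by (rule nn_integral_exp_saw_max_bounded) blast
  have "(\<integral>\<^sup>+x\<in>{0..1}. exp_saw_sup x \<partial>lborel)
      = (\<integral>\<^sup>+x. (SUP n. exp_saw_max (3/4) n x * indicator {0..1} x) \<partial>lborel)"
    unfolding exp_saw_sup_def by (intro nn_integral_cong SUP_mult_right_ennreal)
  also have "\<dots> = (SUP n. \<integral>\<^sup>+x\<in>{0..1}. exp_saw_max (3/4) n x \<partial>lborel)"
  proof (rule nn_integral_monotone_convergence_SUP)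
    show "incseq (\<lambda>n x. exp_saw_max (3/4) n x * indicator {0..1} x)"
      unfolding incseq_def le_fun_def exp_saw_max_def
      by (auto intro!: mult_right_mono SUP_subset_mono)
  qed auto
  also have "\<dots> \<le> ennreal D" by (rule SUP_least) (rule D)
  finally show ?thesis using ennreal_less_top le_less_trans by blast
qed

section \<open>Oscillation of the partial sums\<close>

definition saw_osc_from :: "nat \<Rightarrow> real \<Rightarrow> ennreal" where
  "saw_osc_from N x = (SUP i\<in>{N..}. SUP j\<in>{N..}. ennreal \<bar>saw_sum i x - saw_sum j x\<bar>)"

definition saw_osc :: "real \<Rightarrow> ennreal" where
  "saw_osc x = (INF N. saw_osc_from N x)"

lemma saw_osc_measurable [measurable]: "saw_osc \<in> borel_measurable borel"
  unfolding saw_osc_def saw_osc_from_def by measurable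

lemma saw_osc_add_of_int: "saw_osc (x + of_int k) = saw_osc x"
  by (simp add: saw_osc_def saw_osc_from_def saw_sum_add_of_int)

lemma saw_osc_minus: "x \<notin> \<rat> \<Longrightarrow> saw_osc (- x) = saw_osc x"
  by (simp add: saw_osc_def saw_osc_from_def saw_sum_minus abs_minus_commute)

text \<open>A crude bound that makes the integral of \<open>saw_osc\<close> finite; for an infinite
  integral the contraction would say nothing.\<close>

lemma saw_osc_le_exp_saw_sup: "saw_osc x \<le> 3 * exp_saw_sup x"
proof -
  have "saw_osc x \<le> saw_osc_from 0 x" unfolding saw_osc_def by (rule INF_lower) simp
  also have "\<dots> \<le> 3 * exp_saw_sup x"
    unfolding saw_osc_from_def
  proof (intro SUP_least)
    fix i j
    have e: "\<bar>y\<bar> \<le> 3/2 * exp (3/4 * \<bar>y\<bar>)" for y :: real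
      using exp_ge_add_one_self[of "3/4 * \<bar>y\<bar>"] by linarith
    have "\<bar>saw_sum i x - saw_sum j x\<bar>
        \<le> 3/2 * exp (3/4 * \<bar>saw_sum i x\<bar>) + 3/2 * exp (3/4 * \<bar>saw_sum j x\<bar>)"
      using e[of "saw_sum i x"] e[of "saw_sum j x"] by linarith
    hence "ennreal \<bar>saw_sum i x - saw_sum j x\<bar>
        \<le> ennreal (3/2) * ennreal (exp (3/4 * \<bar>saw_sum i x\<bar>)) + ennreal (3/2) * ennreal (exp (3/4 * \<bar>saw_sum j x\<bar>))"
      by (simp add: ennreal_leI flip: ennreal_mult ennreal_plus)
    also have "\<dots> \<le> ennreal (3/2) * exp_saw_sup x + ennreal (3/2) * exp_saw_sup x"
      by (intro add_mono mult_left_mono exp_saw_sup_upper) auto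
    also have "\<dots> = (ennreal (3/2) + ennreal (3/2)) * exp_saw_sup x"
      by (simp add: distrib_right)
    also have "ennreal (3/2) + ennreal (3/2) = 3"
      by (simp flip: ennreal_plus)
    finally show "ennreal \<bar>saw_sum i x - saw_sum j x\<bar> \<le> 3 * exp_saw_sup x" .
  qed
  finally show ?thesis .
qed

text \<open>The combination \<open>recip_sum n x\<close> converges and contributes no oscillation in
  the limit. What remains is \<open>x < 1/2\<close> times the oscillation at \<open>1 / x\<close>,
  and since the lengths \<open>M n\<close> tend to infinity, late indices correspond to late
  indices.\<close>

lemma saw_osc_recursion:
  assumes x: "0 < x" "x < 1/2" "x \<notin> \<rat>"
  shows "2 * saw_osc x \<le> saw_osc (1 / x)"
  unfolding saw_osc_def[of "1 / x"]
proof (rule INF_greatest, rule ennreal_le_epsilon)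
  fix N and e :: real assume e: "0 < e"
  have "x < 1" using x by simp
  then obtain F where F: "(\<lambda>n. recip_sum n x) \<longlonglongrightarrow> F"
    using recip_sum_tendsto[of x] x by blast
  define M where "M = (\<lambda>n. nat \<lfloor>real n * x\<rfloor>)"
  have "\<forall>\<^sub>F n in sequentially. dist (recip_sum n x) F < e / 4"
    using F e by (auto dest: tendstoD[where e = "e / 4"])
  moreover have "\<forall>\<^sub>F n in sequentially. M n \<ge> N"
    using filterlim_nat_floor_mult[of x] x unfolding M_def filterlim_at_top by auto
  ultimately have "\<forall>\<^sub>F n in sequentially. dist (recip_sum n x) F < e / 4 \<and> M n \<ge> N"
    by (rule eventually_conj)
  then obtain N' where N': "\<And>n. n \<ge> N' \<Longrightarrow> dist (recip_sum n x) F < e / 4 \<and> M n \<ge> N"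
    unfolding eventually_sequentially by blast
  have "2 * saw_osc x \<le> 2 * saw_osc_from N' x"
    unfolding saw_osc_def by (intro mult_left_mono INF_lower) auto
  also have "\<dots> = (SUP i\<in>{N'..}. SUP j\<in>{N'..}. 2 * ennreal \<bar>saw_sum i x - saw_sum j x\<bar>)"
    unfolding saw_osc_from_def by (simp add: SUP_mult_left_ennreal)
  also have "\<dots> \<le> saw_osc_from N (1 / x) + ennreal e"
  proof (intro SUP_least)
    fix i j assume ij: "i \<in> {N'..}" "j \<in> {N'..}"
    define u where "u = saw_sum (M i) (1 / x) - saw_sum (M j) (1 / x)"
    have "saw_sum i x - saw_sum j x = (recip_sum i x - recip_sum j x) - x * u"
      by (simp add: recip_sum_def M_def u_def algebra_simps)
    hence "\<bar>saw_sum i x - saw_sum j x\<bar> \<le> \<bar>recip_sum i x - recip_sum j x\<bar> + x * \<bar>u\<bar>"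
      using x abs_triangle_ineq4[of "recip_sum i x - recip_sum j x" "x * u"] by (simp add: abs_mult)
    also have "\<bar>recip_sum i x - recip_sum j x\<bar> \<le> e / 2"
    proof -
      have "dist (recip_sum i x) F < e / 4" "dist (recip_sum j x) F < e / 4"
        using N' ij by auto
      thus ?thesis unfolding dist_real_def by linarith
    qed
    also have "x * \<bar>u\<bar> \<le> 1/2 * \<bar>u\<bar>" using x by (intro mult_right_mono) auto
    finally have "2 * \<bar>saw_sum i x - saw_sum j x\<bar> \<le> \<bar>u\<bar> + e" by simp
    hence "2 * ennreal \<bar>saw_sum i x - saw_sum j x\<bar> \<le> ennreal \<bar>u\<bar> + ennreal e"
      using e by (simp add: ennreal_leI flip: ennreal_plus ennreal_numeral ennreal_mult)
    also have "ennreal \<bar>u\<bar> \<le> saw_osc_from N (1 / x)"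
      unfolding saw_osc_from_def u_def using N' ij
      by (intro SUP_upper2[of "M i"] SUP_upper2[of "M j"]) auto
    finally show "2 * ennreal \<bar>saw_sum i x - saw_sum j x\<bar> \<le> saw_osc_from N (1 / x) + ennreal e"
      by (simp add: add_right_mono)
  qed
  finally show "2 * saw_osc x \<le> saw_osc_from N (1 / x) + ennreal e" .
qed

text \<open>Evenness gives twice the integral over the half interval, the recursion absorbs this
  factor 2 in passing to \<open>1 / x\<close>, and inversion returns to the full interval with
  factor 2/3. A finite \<open>J\<close> with \<open>J <= 2/3 * J\<close> vanishes.\<close>

lemma nn_integral_saw_osc_eq_0: "(\<integral>\<^sup>+x\<in>{0..1}. saw_osc x \<partial>lborel) = 0"
proof -
  define J where "J = (\<integral>\<^sup>+x\<in>{0..1}. saw_osc x \<partial>lborel)"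
  have "J \<le> (\<integral>\<^sup>+x. 3 * (exp_saw_sup x * indicator {0..1} x) \<partial>lborel)"
    unfolding J_def
    by (intro nn_integral_mono) (auto simp: indicator_def saw_osc_le_exp_saw_sup)
  also have "\<dots> = 3 * (\<integral>\<^sup>+x\<in>{0..1}. exp_saw_sup x \<partial>lborel)"
    by (rule nn_integral_cmult) measurable
  also have "\<dots> < top"
    using nn_integral_exp_saw_sup_finite by (simp add: ennreal_mult_less_top)
  finally obtain r where r: "J = ennreal r" "r \<ge> 0" by (cases J) auto
  have "J = 2 * (\<integral>\<^sup>+x\<in>{0<..<1/2}. saw_osc x \<partial>lborel)"
    unfolding J_def
    by (rule nn_integral_unit_interval_even_periodic)
       (use AE_lborel_irrational in \<open>auto simp: saw_osc_add_of_int saw_osc_minus\<close>)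
  also have "\<dots> = (\<integral>\<^sup>+x. 2 * (saw_osc x * indicator {0<..<1/2} x) \<partial>lborel)"
    by (subst nn_integral_cmult) auto
  also have "\<dots> \<le> (\<integral>\<^sup>+x\<in>{0<..<1/2}. ennreal (x powr (- 0)) * saw_osc (1 / x) \<partial>lborel)"
  proof (rule nn_integral_mono_AE, use AE_lborel_irrational in eventually_elim)
    case (elim x)
    show ?case using saw_osc_recursion[of x] elim by (auto simp: indicator_def)
  qed
  also have "\<dots> \<le> ennreal (\<Sum>n. (real n + 2) powr (0 - 2)) * J"
    unfolding J_def by (rule nn_integral_reciprocal_le) (auto simp: saw_osc_add_of_int)
  also have "\<dots> \<le> ennreal (2/3) * J"
    by (intro mult_right_mono ennreal_leI suminf_inverse_squares_shift_le) auto
  finally have "r \<le> 2/3 * r"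
    unfolding r(1) using r(2) by (simp flip: ennreal_mult)
  hence "J = 0" using r by simp
  thus ?thesis by (simp add: J_def)
qed

lemma saw_osc_eq_0_imp_convergent:
  assumes "saw_osc x = 0"
  shows "convergent (\<lambda>n. saw_sum n x)"
proof (rule Cauchy_convergent, rule CauchyI)
  fix e :: real assume e: "0 < e"
  have "(INF N. saw_osc_from N x) < ennreal e"
    using assms e by (simp add: saw_osc_def)
  then obtain N where N: "saw_osc_from N x < ennreal e" by (auto simp: INF_less_iff)
  have "norm (saw_sum i x - saw_sum j x) < e" if "i \<ge> N" "j \<ge> N" for i j
  proof -
    have "ennreal \<bar>saw_sum i x - saw_sum j x\<bar> \<le> saw_osc_from N x"
      unfolding saw_osc_from_def using that by (intro SUP_upper2[of i] SUP_upper2[of j]) auto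
    also note N
    finally show ?thesis by (simp add: ennreal_less_iff)
  qed
  thus "\<exists>N. \<forall>i\<ge>N. \<forall>j\<ge>N. norm (saw_sum i x - saw_sum j x) < e" by blast
qed

lemma AE_saw_sum_convergent: "AE x in lborel. x \<in> {0..1} \<longrightarrow> convergent (\<lambda>n. saw_sum n x)"
proof -
  have "AE x in lborel. saw_osc x * indicator {0..1} x = 0"
    using nn_integral_saw_osc_eq_0 by (subst (asm) nn_integral_0_iff_AE) auto
  thus ?thesis
    by eventually_elim (auto simp: indicator_def intro: saw_osc_eq_0_imp_convergent)
qed

text \<open>The integral inequality for the inversion, with exponent 0, shows that the oscillation
  at \<open>1 / x\<close> also vanishes almost everywhere.\<close>

lemma AE_saw_sum_reciprocal_convergent:
  "AE x in lborel. x \<in> {0<..<1/2} \<longrightarrow> convergent (\<lambda>n. saw_sum n (1 / x))"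
proof -
  have "(\<integral>\<^sup>+x\<in>{0<..<1/2}. ennreal (x powr (- 0)) * saw_osc (1 / x) \<partial>lborel)
      \<le> ennreal (\<Sum>n. (real n + 2) powr (0 - 2)) * (\<integral>\<^sup>+x\<in>{0..1}. saw_osc x \<partial>lborel)"
    by (rule nn_integral_reciprocal_le) (auto simp: saw_osc_add_of_int)
  hence "(\<integral>\<^sup>+x\<in>{0<..<1/2}. ennreal (x powr (- 0)) * saw_osc (1 / x) \<partial>lborel) = 0"
    by (simp add: nn_integral_saw_osc_eq_0)
  hence "AE x in lborel. ennreal (x powr (- 0)) * saw_osc (1 / x) * indicator {0<..<1/2} x = 0"
    by (subst (asm) nn_integral_0_iff_AE) auto
  thus ?thesis
    by eventually_elim (auto simp: indicator_def intro: saw_osc_eq_0_imp_convergent)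
qed

section \<open>Moments\<close>

text \<open>Integration by parts gives the factorial recursion. The boundary terms vanish at 0
  because \<open>x\<close> dominates powers of the logarithm, and at \<open>exp (- A)\<close>
  because \<open>- ln x - A\<close> is zero there.\<close>

lemma log_power_antiderivative:
  fixes A :: real
  shows "\<exists>F. (\<forall>x>0. (F has_real_derivative (- ln x - A) ^ K) (at x)) \<and>
    (F \<longlongrightarrow> 0) (at_right 0) \<and> F (exp (- A)) = exp (- A) * fact K"
proof (induction K)
  case 0
  have "((\<lambda>x::real. x) \<longlongrightarrow> 0) (at_right 0)" by (rule tendsto_ident_at)
  thus ?case by (intro exI[of _ "\<lambda>x. x"]) auto
next
  case (Suc K)
  then obtain F where F: "\<And>x. x > 0 \<Longrightarrow> (F has_real_derivative (- ln x - A) ^ K) (at x)"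
    "(F \<longlongrightarrow> 0) (at_right 0)" "F (exp (- A)) = exp (- A) * fact K" by blast
  define G where "G = (\<lambda>x. real (Suc K) * F x + x * (- ln x - A) ^ Suc K)"
  have "(G has_real_derivative (- ln x - A) ^ Suc K) (at x)" if x: "x > 0" for x
  proof -
    have "(G has_real_derivative (real (Suc K) * (- ln x - A) ^ K + (1 * (- ln x - A) ^ Suc K
       + real (Suc K) * (- ln x - A) ^ K * (- (1 / x)) * x))) (at x)"
      unfolding G_def
      by (rule DERIV_add DERIV_cmult F x | rule derivative_eq_intros refl x | simp)+
    thus ?thesis using x by simp
  qed
  moreover have "((\<lambda>x. x * (- ln x - A) ^ Suc K) \<longlongrightarrow> 0) (at_right 0)" by real_asymp
  hence "(G \<longlongrightarrow> real (Suc K) * 0 + 0) (at_right 0)"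
    unfolding G_def by (intro tendsto_intros F(2))
  moreover have "G (exp (- A)) = exp (- A) * fact (Suc K)" by (simp add: G_def F(3))
  ultimately show ?case by (intro exI[of _ G]) simp
qed

lemma set_integral_log_power:
  fixes A :: real
  shows "(LINT x:{0<..<exp (- A)}|lborel. (ln (1 / x) - A) ^ K) = exp (- A) * fact K"
proof -
  obtain F where F: "\<And>x. x > 0 \<Longrightarrow> (F has_real_derivative (- ln x - A) ^ K) (at x)"
    "(F \<longlongrightarrow> 0) (at_right 0)" "F (exp (- A)) = exp (- A) * fact K"
    using log_power_antiderivative[of A K] by blast
  have lt: "ereal 0 < ereal (exp (- A))" by simp
  have der: "DERIV F x :> (- ln x - A) ^ K" if "ereal 0 < ereal x" for x
    using F(1) that by simp
  have cont: "isCont (\<lambda>x. (- ln x - A) ^ K) x" if "ereal 0 < ereal x" for x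
    using that by (intro continuous_intros) auto
  have "0 \<le> - ln x - A" if "0 < x" "x < exp (- A)" for x :: real
    using that by (metis diff_ge_0_iff_ge le_minus_iff less_eq_real_def ln_exp ln_le_cancel_iff exp_gt_zero)
  hence nonneg: "AE x in lborel. ereal 0 < ereal x \<longrightarrow> ereal x < ereal (exp (- A)) \<longrightarrow> 0 \<le> (- ln x - A) ^ K"
    by auto
  have lim0: "((F \<circ> real_of_ereal) \<longlongrightarrow> 0) (at_right (ereal 0))"
    unfolding ereal_tendsto_simps by (rule F(2))
  have lim1: "((F \<circ> real_of_ereal) \<longlongrightarrow> F (exp (- A))) (at_left (ereal (exp (- A))))"
    unfolding ereal_tendsto_simps
    using DERIV_isCont[OF F(1)[OF exp_gt_zero[of "- A"]]]
    by (auto simp: isCont_def intro: filterlim_at_split[THEN iffD1, THEN conjunct1])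
  note FTC = interval_integral_FTC_nonneg[OF lt der cont nonneg lim0 lim1]
  have sets: "einterval (ereal 0) (ereal (exp (- A))) = {0<..<exp (- A)}" by (simp add: einterval_eq)
  have eq: "(- ln x - A) ^ K = (ln (1 / x) - A) ^ K" if "x \<in> {0<..<exp (- A)}" for x
    using that by (simp add: ln_div)
  have "(LINT x:{0<..<exp (- A)}|lborel. (ln (1 / x) - A) ^ K)
      = (LINT x:{0<..<exp (- A)}|lborel. (- ln x - A) ^ K)"
    by (rule set_lebesgue_integral_cong) (auto simp: eq)
  also have "\<dots> = exp (- A) * fact K"
    using FTC(2) F(3) by (simp add: interval_lebesgue_integral_def sets)
  finally show "(LINT x:{0<..<exp (- A)}|lborel. (ln (1 / x) - A) ^ K) = exp (- A) * fact K" .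
qed

text \<open>A single term of the exponential series is at most the whole. The rate
  \<open>t = 3/4\<close> serves for integrability of powers, while \<open>t = 5/4 > 1\<close> yields
  the exponential gain over \<open>fact n\<close>.\<close>

lemma power_le_fact_exp:
  fixes y t :: real
  assumes "y \<ge> 0" "t > 0"
  shows "y ^ n \<le> fact n * (1 / t) ^ n * exp (t * y)"
proof -
  have "(\<lambda>n. (t * y) ^ n /\<^sub>R fact n) sums exp (t * y)" by (rule exp_converges)
  hence "(t * y) ^ n /\<^sub>R fact n \<le> exp (t * y)"
    using sum_le_suminf[of "\<lambda>n. (t * y) ^ n /\<^sub>R fact n" "{n}"] assms by (auto simp: sums_iff)
  thus ?thesis using assms by (simp add: field_simps power_mult_distrib)
qed

lemma abs_power_diff_le:
  fixes a b m :: real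
  assumes "\<bar>a\<bar> \<le> m" "\<bar>b\<bar> \<le> m"
  shows "\<bar>a ^ Suc n - b ^ Suc n\<bar> \<le> real (Suc n) * \<bar>a - b\<bar> * m ^ n"
proof (induction n)
  case (Suc n)
  have m: "m \<ge> 0" using assms(1) by linarith
  have "a ^ Suc (Suc n) - b ^ Suc (Suc n) = a * (a ^ Suc n - b ^ Suc n) + (a - b) * b ^ Suc n"
    by (simp add: algebra_simps)
  hence "\<bar>a ^ Suc (Suc n) - b ^ Suc (Suc n)\<bar> \<le> \<bar>a\<bar> * \<bar>a ^ Suc n - b ^ Suc n\<bar> + \<bar>a - b\<bar> * \<bar>b\<bar> ^ Suc n"
    by (metis abs_mult abs_triangle_ineq power_abs)
  also have "\<dots> \<le> m * (real (Suc n) * \<bar>a - b\<bar> * m ^ n) + \<bar>a - b\<bar> * m ^ Suc n"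
    using assms m Suc.IH by (intro add_mono mult_mono power_mono) auto
  also have "\<dots> = real (Suc (Suc n)) * \<bar>a - b\<bar> * m ^ Suc n" by (simp add: algebra_simps)
  finally show ?case .
qed auto

section \<open>Symmetry, reciprocity and integrability of g\<close>

lemma g_measurable [measurable]: "g \<in> borel_measurable borel"
  unfolding g_def frac_def by measurable

lemma g_add_of_int: "g (x + of_int k) = g x"
proof -
  have "saw (real (Suc l) * (x + of_int k)) = saw (real (Suc l) * x)" for l
    using saw_add_of_int[of "real (Suc l) * x" "int (Suc l) * k"] by (simp add: algebra_simps)
  thus ?thesis by (simp add: g_def saw_def)
qed

lemma saw_sum_tendsto_g: "convergent (\<lambda>n. saw_sum n x) \<Longrightarrow> (\<lambda>n. saw_sum n x) \<longlonglongrightarrow> g x"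
  using g_conv_saw_sum unfolding convergent_def by metis

lemma AE_g_minus: "AE x in lborel. x \<in> {0..1} \<longrightarrow> g (- x) = - g x"
  using AE_saw_sum_convergent AE_lborel_irrational
proof eventually_elim
  case (elim x)
  show ?case
  proof
    assume "x \<in> {0..1}"
    hence "(\<lambda>n. saw_sum n x) \<longlonglongrightarrow> g x" using elim saw_sum_tendsto_g by blast
    hence "(\<lambda>n. saw_sum n (- x)) \<longlonglongrightarrow> - g x"
      using elim by (simp add: saw_sum_minus tendsto_minus)
    thus "g (- x) = - g x" by (rule g_conv_saw_sum)
  qed
qed

text \<open>Almost everywhere the sums converge at both \<open>x\<close> and \<open>1 / x\<close>,
  so the limit \<open>F\<close> of the reciprocity sums is
  \<open>g x + x * g (1 / x)\<close>.\<close>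

lemma AE_g_reciprocity:
  "AE x in lborel. x \<in> {0<..<1/2} \<longrightarrow> \<bar>g x - (ln (1 / x) - A_const)\<bar> \<le> 9 * x + x * \<bar>g (1 / x)\<bar>"
  using AE_saw_sum_convergent AE_saw_sum_reciprocal_convergent AE_lborel_irrational
proof eventually_elim
  case (elim x)
  show ?case
  proof
    assume x: "x \<in> {0<..<1/2}"
    then obtain F where F: "(\<lambda>n. recip_sum n x) \<longlonglongrightarrow> F" "\<bar>F - (ln (1 / x) - A_const)\<bar> \<le> 9 * x"
      using recip_sum_tendsto[of x] elim by auto
    have "(\<lambda>n. saw_sum n x + x * saw_sum (nat \<lfloor>real n * x\<rfloor>) (1 / x)) \<longlonglongrightarrow> g x + x * g (1 / x)"
      using x elim
      by (intro tendsto_intros saw_sum_tendsto_g filterlim_compose[OF saw_sum_tendsto_g filterlim_nat_floor_mult]) auto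
    hence "F = g x + x * g (1 / x)"
      using F(1) LIMSEQ_unique unfolding recip_sum_def by blast
    moreover have "\<bar>x * g (1 / x)\<bar> = x * \<bar>g (1 / x)\<bar>" using x by (simp add: abs_mult)
    ultimately show "\<bar>g x - (ln (1 / x) - A_const)\<bar> \<le> 9 * x + x * \<bar>g (1 / x)\<bar>"
      using F(2) by linarith
  qed
qed

lemma nn_integral_exp_g_finite: "(\<integral>\<^sup>+x\<in>{0..1}. ennreal (exp (3/4 * \<bar>g x\<bar>)) \<partial>lborel) < top"
proof -
  have "(\<integral>\<^sup>+x\<in>{0..1}. ennreal (exp (3/4 * \<bar>g x\<bar>)) \<partial>lborel) \<le> (\<integral>\<^sup>+x\<in>{0..1}. exp_saw_sup x \<partial>lborel)"
  proof (rule nn_integral_mono_AE, use AE_saw_sum_convergent in eventually_elim)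
    case (elim x)
    show ?case
    proof (cases "x \<in> {0..1}")
      case True
      hence "(\<lambda>n. saw_sum n x) \<longlonglongrightarrow> g x" using elim saw_sum_tendsto_g by blast
      hence "(\<lambda>n. ennreal (exp (3/4 * \<bar>saw_sum n x\<bar>))) \<longlonglongrightarrow> ennreal (exp (3/4 * \<bar>g x\<bar>))"
        by (intro tendsto_intros) auto
      hence "ennreal (exp (3/4 * \<bar>g x\<bar>)) \<le> exp_saw_sup x"
        by (rule LIMSEQ_le_const2) (use exp_saw_sup_upper in auto)
      thus ?thesis using True by simp
    qed auto
  qed
  also note nn_integral_exp_saw_sup_finite
  finally show ?thesis .
qed

text \<open>This function dominates the difference between powers of \<open>g\<close> and powers of
  the logarithm. The weight exponent 1/4 is below 1, as inversion requires.\<close>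

lemma set_integrable_exp_g_reciprocal:
  "set_integrable lborel {0<..<1/2} (\<lambda>x. x powr (- (1/4)) * exp (3/4 * \<bar>g (1 / x)\<bar>))"
proof -
  have "(\<integral>\<^sup>+x\<in>{0<..<1/2}. ennreal (x powr (- (1/4))) * ennreal (exp (3/4 * \<bar>g (1 / x)\<bar>)) \<partial>lborel)
      \<le> ennreal (\<Sum>n. (real n + 2) powr (1/4 - 2)) * (\<integral>\<^sup>+x\<in>{0..1}. ennreal (exp (3/4 * \<bar>g x\<bar>)) \<partial>lborel)"
    by (rule nn_integral_reciprocal_le) (auto simp: g_add_of_int)
  also have "\<dots> < top" using nn_integral_exp_g_finite by (simp add: ennreal_mult_less_top)
  also have "(\<integral>\<^sup>+x\<in>{0<..<1/2}. ennreal (x powr (- (1/4))) * ennreal (exp (3/4 * \<bar>g (1 / x)\<bar>)) \<partial>lborel)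
     = (\<integral>\<^sup>+x. ennreal (norm (indicator {0<..<1/2} x *\<^sub>R (x powr (- (1/4)) * exp (3/4 * \<bar>g (1 / x)\<bar>)))) \<partial>lborel)"
    by (rule nn_integral_cong) (auto simp: indicator_def ennreal_mult)
  finally show ?thesis
    unfolding set_integrable_def by (intro integrableI_bounded) auto
qed

lemma set_integrable_abs_g_power: "set_integrable lborel {0..1} (\<lambda>x. \<bar>g x\<bar> ^ K)"
proof -
  have "(\<integral>\<^sup>+x. ennreal (norm (indicator {0..1} x *\<^sub>R \<bar>g x\<bar> ^ K)) \<partial>lborel)
    \<le> (\<integral>\<^sup>+x. ennreal (fact K * (4/3) ^ K) * (ennreal (exp (3/4 * \<bar>g x\<bar>)) * indicator {0..1} x) \<partial>lborel)"
  proof (rule nn_integral_mono)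
    fix x
    show "ennreal (norm (indicator {0..1} x *\<^sub>R \<bar>g x\<bar> ^ K))
      \<le> ennreal (fact K * (4/3) ^ K) * (ennreal (exp (3/4 * \<bar>g x\<bar>)) * indicator {0..1} x)"
      using power_le_fact_exp[of "\<bar>g x\<bar>" "3/4" K]
      by (auto simp: indicator_def ennreal_leI power_abs simp flip: ennreal_mult)
  qed
  also have "\<dots> = ennreal (fact K * (4/3) ^ K) * (\<integral>\<^sup>+x\<in>{0..1}. ennreal (exp (3/4 * \<bar>g x\<bar>)) \<partial>lborel)"
    by (rule nn_integral_cmult) measurable
  also have "\<dots> < top" using nn_integral_exp_g_finite by (simp add: ennreal_mult_less_top)
  finally show ?thesis
    unfolding set_integrable_def by (intro integrableI_bounded) auto
qed

text \<open>Reduces the moments to \<open>(0, 1/2)\<close>, where reciprocity is available; oddness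
  of \<open>g\<close> almost everywhere makes the integrand even.\<close>

lemma set_integral_abs_g_power_half:
  "(LINT x:{0<..<1}|lborel. \<bar>g x\<bar> ^ K) = 2 * (LINT x:{0<..<1/2}|lborel. \<bar>g x\<bar> ^ K)"
proof -
  have conv: "(LINT x:S|lborel. \<bar>g x\<bar> ^ K) = enn2real (\<integral>\<^sup>+x\<in>S. ennreal (\<bar>g x\<bar> ^ K) \<partial>lborel)"
    if [measurable]: "S \<in> sets borel" for S
  proof -
    have "(LINT x:S|lborel. \<bar>g x\<bar> ^ K) = enn2real (\<integral>\<^sup>+x. ennreal (indicator S x *\<^sub>R \<bar>g x\<bar> ^ K) \<partial>lborel)"
      unfolding set_lebesgue_integral_def by (rule integral_eq_nn_integral) auto
    also have "(\<integral>\<^sup>+x. ennreal (indicator S x *\<^sub>R \<bar>g x\<bar> ^ K) \<partial>lborel) = (\<integral>\<^sup>+x\<in>S. ennreal (\<bar>g x\<bar> ^ K) \<partial>lborel)"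
      by (rule nn_integral_cong) (auto simp: indicator_def)
    finally show ?thesis .
  qed
  have "(\<integral>\<^sup>+x\<in>{0<..<1}. ennreal (\<bar>g x\<bar> ^ K) \<partial>lborel) = (\<integral>\<^sup>+x\<in>{0..1}. ennreal (\<bar>g x\<bar> ^ K) \<partial>lborel)"
  proof (rule nn_integral_cong_AE, use AE_lborel_irrational in eventually_elim)
    case (elim x)
    hence "x \<noteq> 0" "x \<noteq> 1" by auto
    thus ?case by (auto simp: indicator_def)
  qed
  also have "\<dots> = 2 * (\<integral>\<^sup>+x\<in>{0<..<1/2}. ennreal (\<bar>g x\<bar> ^ K) \<partial>lborel)"
  proof (rule nn_integral_unit_interval_even_periodic)
    show "AE x in lborel. x \<in> {0<..<1/2} \<longrightarrow> ennreal (\<bar>g (- x)\<bar> ^ K) = ennreal (\<bar>g x\<bar> ^ K)"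
      using AE_g_minus by eventually_elim auto
  qed (auto simp: g_add_of_int)
  finally show ?thesis by (simp add: conv enn2real_mult)
qed

text \<open>Powers are compared at the exponential rate 5/4, which alone would cost the
  nonintegrable \<open>x powr (- (5/4))\<close>. The difference of the bases carries a factor
  \<open>x\<close> and leaves \<open>x powr (- (1/4))\<close>. The exponents of
  \<open>\<bar>G\<bar>\<close> add up to \<open>1/8 + 5/4 * 1/2 = 3/4\<close>, exactly the
  integrable one, and \<open>45/8 = 5/4 * 9/2\<close>.\<close>

lemma power_difference_bound:
  fixes A G x y :: real and n :: nat
  defines "l \<equiv> ln (1 / x) - A"
  assumes x: "0 < x" "x < 1/2" and A: "A \<ge> 0" and y: "\<bar>y - l\<bar> \<le> 9 * x + x * \<bar>G\<bar>"
  shows "\<bar>\<bar>y\<bar> ^ Suc n - \<bar>l\<bar> ^ Suc n\<bar>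
    \<le> fact (Suc n) * (4/5) ^ n * (9 * exp (5/4 * A + 45/8)) * (x powr (- (1/4)) * exp (3/4 * \<bar>G\<bar>))"
proof -
  define e where "e = \<bar>y - l\<bar>"
  have e0: "e \<ge> 0" by (simp add: e_def)
  have "1 + \<bar>G\<bar> / 8 \<le> exp (\<bar>G\<bar> / 8)" by (rule exp_ge_add_one_self)
  hence "9 + \<bar>G\<bar> \<le> 9 * exp (\<bar>G\<bar> / 8)" by linarith
  hence "x * (9 + \<bar>G\<bar>) \<le> x * (9 * exp (\<bar>G\<bar> / 8))" using x by (intro mult_left_mono) auto
  hence e1: "e \<le> 9 * x * exp (\<bar>G\<bar> / 8)" using y by (simp add: e_def algebra_simps)
  \<comment> \<open>A second bound for the same error, linear in \<open>\<bar>G\<bar>\<close> and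
    without an exponential, for use inside the exponent.\<close>
  have "x * (9 + \<bar>G\<bar>) \<le> 1/2 * (9 + \<bar>G\<bar>)" using x by (intro mult_right_mono) auto
  hence e2: "e \<le> 9/2 + \<bar>G\<bar> / 2" using y by (simp add: e_def algebra_simps)
  have "ln (1 / x) \<ge> 0" using x by simp
  hence l1: "\<bar>l\<bar> \<le> ln (1 / x) + A" using A by (simp add: l_def)
  have "\<bar>\<bar>y\<bar> ^ Suc n - \<bar>l\<bar> ^ Suc n\<bar> \<le> real (Suc n) * \<bar>\<bar>y\<bar> - \<bar>l\<bar>\<bar> * (\<bar>l\<bar> + e) ^ n"
    by (rule abs_power_diff_le) (auto simp: e_def)
  also have "\<dots> \<le> real (Suc n) * e * (fact n * (1 / (5/4)) ^ n * exp (5/4 * (\<bar>l\<bar> + e)))"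
    by (intro mult_mono power_le_fact_exp) (auto simp: e_def)
  also have "\<dots> = fact (Suc n) * (4/5) ^ n * (e * exp (5/4 * (\<bar>l\<bar> + e)))"
    by (simp add: algebra_simps)
  also have "e * exp (5/4 * (\<bar>l\<bar> + e)) \<le> (9 * x * exp (\<bar>G\<bar> / 8)) *
      exp (5/4 * ((ln (1 / x) + A) + (9/2 + \<bar>G\<bar> / 2)))"
    using e0 e1 e2 l1 x by (intro mult_mono) auto
  also have "\<dots> = 9 * exp (5/4 * A + 45/8) * (x powr (- (1/4)) * exp (3/4 * \<bar>G\<bar>))"
  proof -
    have "x = exp (ln x)" using x by simp
    hence "(9 * x * exp (\<bar>G\<bar> / 8)) * exp (5/4 * ((ln (1 / x) + A) + (9/2 + \<bar>G\<bar> / 2)))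
        = 9 * (exp (ln x) * exp (\<bar>G\<bar> / 8) * exp (5/4 * ((ln (1 / x) + A) + (9/2 + \<bar>G\<bar> / 2))))"
      by simp
    also have "\<dots> = 9 * (exp (5/4 * A + 45/8) * exp (- (1/4) * ln x) * exp (3/4 * \<bar>G\<bar>))"
      using x by (simp only: ln_div ln_one flip: exp_add) (simp add: ln_div algebra_simps)
    finally show ?thesis using x by (simp add: powr_def mult_ac)
  qed
  finally show ?thesis by (simp add: mult_left_mono mult.assoc)
qed

section \<open>Comparison of the moments with those of the logarithm\<close>

lemma A_const_ge_1: "A_const \<ge> 1"
  using sum_le_suminf[of frac_sq_term "{0}"] frac_sq_term_sums frac_sq_term_nonneg
  by (auto simp: sums_iff frac_sq_term_def)

text \<open>Places the zero of \<open>ln (1 / x) - A_const\<close> inside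
  \<open>(0, 1/2)\<close>.\<close>

lemma exp_minus_A_const_less: "exp (- A_const) < 1/2"
proof -
  have "exp (- A_const) < exp (- ln 2)"
    using A_const_ge_1 ln_2_less_1 by simp
  also have "exp (- ln 2) = (1/2 :: real)" by (simp add: exp_minus)
  finally show ?thesis .
qed

lemma half_moment_near_log_moment:
  obtains D where "D \<ge> 0"
    "\<And>n. set_integrable lborel {0<..<1/2} (\<lambda>x. \<bar>ln (1 / x) - A_const\<bar> ^ Suc n)"
    "\<And>n. \<bar>(LINT x:{0<..<1/2}|lborel. \<bar>g x\<bar> ^ Suc n) - (LINT x:{0<..<1/2}|lborel. \<bar>ln (1 / x) - A_const\<bar> ^ Suc n)\<bar>
       \<le> D * (fact (Suc n) * (4/5) ^ n)"
proof -
  define Q where "Q = (\<lambda>x. x powr (- (1/4)) * exp (3/4 * \<bar>g (1 / x)\<bar>))"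
  define c where "c = 9 * exp (5/4 * A_const + 45/8)"
  define D where "D = c * (LINT x:{0<..<1/2}|lborel. Q x)"
  have Q0: "Q x \<ge> 0" for x by (simp add: Q_def)
  have Qint: "set_integrable lborel {0<..<1/2} Q"
    unfolding Q_def by (rule set_integrable_exp_g_reciprocal)
  have D0: "D \<ge> 0"
    unfolding D_def c_def set_lebesgue_integral_def using Q0
    by (intro mult_nonneg_nonneg integral_nonneg_AE) auto
  define l where "l = (\<lambda>x. ln (1 / x) - A_const)"
  have diff: "AE x in lborel. x \<in> {0<..<1/2} \<longrightarrow>
      \<bar>\<bar>g x\<bar> ^ Suc n - \<bar>l x\<bar> ^ Suc n\<bar> \<le> fact (Suc n) * (4/5) ^ n * c * Q x" for n
    using AE_g_reciprocity
  proof eventually_elim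
    case (elim x)
    thus ?case
      using power_difference_bound[of x A_const "g x" "g (1 / x)" n] A_const_nonneg
      by (auto simp: l_def c_def Q_def)
  qed
  have gint: "set_integrable lborel {0<..<1/2} (\<lambda>x. \<bar>g x\<bar> ^ K)" for K
    by (rule set_integrable_subset[OF set_integrable_abs_g_power]) auto
  have bint: "set_integrable lborel {0<..<1/2} (\<lambda>x. fact (Suc n) * (4/5) ^ n * c * Q x)" for n
    using Qint by (rule set_integrable_mult_right)
  have dint: "set_integrable lborel {0<..<1/2} (\<lambda>x. \<bar>g x\<bar> ^ Suc n - \<bar>l x\<bar> ^ Suc n)" for n
  proof (rule set_integrable_bound[OF bint[of n]])
    show "set_borel_measurable lborel {0<..<1/2} (\<lambda>x. \<bar>g x\<bar> ^ Suc n - \<bar>l x\<bar> ^ Suc n)"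
      unfolding set_borel_measurable_def l_def by measurable
    show "AE x in lborel. x \<in> {0<..<1/2} \<longrightarrow>
        norm (\<bar>g x\<bar> ^ Suc n - \<bar>l x\<bar> ^ Suc n) \<le> norm (fact (Suc n) * (4/5) ^ n * c * Q x)"
      using diff[of n]
    proof eventually_elim
      case (elim x)
      thus ?case using order_trans[OF _ abs_ge_self] by auto
    qed
  qed
  \<comment> \<open>Integrability of the logarithmic power is a by-product: it is the power of
    \<open>\<bar>g\<bar>\<close> minus the dominated difference.\<close>
  have lint: "set_integrable lborel {0<..<1/2} (\<lambda>x. \<bar>l x\<bar> ^ Suc n)" for n
    using set_integral_diff(1)[OF gint[of "Suc n"] dint[of n]] by simp
  show ?thesis
  proof
    show "D \<ge> 0" by (rule D0)
    show "set_integrable lborel {0<..<1/2} (\<lambda>x. \<bar>ln (1 / x) - A_const\<bar> ^ Suc n)" for n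
      using lint[of n] by (simp add: l_def)
    show "\<bar>(LINT x:{0<..<1/2}|lborel. \<bar>g x\<bar> ^ Suc n) - (LINT x:{0<..<1/2}|lborel. \<bar>ln (1 / x) - A_const\<bar> ^ Suc n)\<bar>
       \<le> D * (fact (Suc n) * (4/5) ^ n)" for n
    proof -
      have "(LINT x:{0<..<1/2}|lborel. \<bar>g x\<bar> ^ Suc n) - (LINT x:{0<..<1/2}|lborel. \<bar>l x\<bar> ^ Suc n)
        = (LINT x:{0<..<1/2}|lborel. \<bar>g x\<bar> ^ Suc n - \<bar>l x\<bar> ^ Suc n)"
        by (rule set_integral_diff(2)[symmetric]) (rule gint lint)+
      also have "\<bar>\<dots>\<bar> \<le> (LINT x:{0<..<1/2}|lborel. fact (Suc n) * (4/5) ^ n * c * Q x)"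
        unfolding set_lebesgue_integral_def
      proof (rule order_trans[OF integral_abs_bound integral_mono_AE])
        show "integrable lborel (\<lambda>x. \<bar>indicator {0<..<1/2} x *\<^sub>R (\<bar>g x\<bar> ^ Suc n - \<bar>l x\<bar> ^ Suc n)\<bar>)"
          using dint[of n] unfolding set_integrable_def by (rule integrable_abs)
        show "integrable lborel (\<lambda>x. indicator {0<..<1/2} x *\<^sub>R (fact (Suc n) * (4/5) ^ n * c * Q x))"
          using bint[of n] unfolding set_integrable_def .
        show "AE x in lborel. \<bar>indicator {0<..<1/2} x *\<^sub>R (\<bar>g x\<bar> ^ Suc n - \<bar>l x\<bar> ^ Suc n)\<bar>
            \<le> indicator {0<..<1/2} x *\<^sub>R (fact (Suc n) * (4/5) ^ n * c * Q x)"
          using diff[of n] by eventually_elim (auto simp: indicator_def)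
      qed
      also have "\<dots> = D * (fact (Suc n) * (4/5) ^ n)"
        by (simp add: D_def mult_ac)
      finally show ?thesis by (simp add: l_def)
    qed
  qed
qed

text \<open>Splitting at the zero \<open>b = exp (- A_const)\<close> gives the exact main term on
  the left. On the right the logarithm lies between 0 and \<open>A_const\<close>, so the rest is at
  most \<open>A_const ^ K\<close>, which the exponential series bounds by a multiple of
  \<open>fact K * (4/5) ^ K\<close>.\<close>

lemma log_moment_half:
  assumes int: "set_integrable lborel {0<..<1/2} (\<lambda>x. \<bar>ln (1 / x) - A_const\<bar> ^ K)"
  shows "\<bar>(LINT x:{0<..<1/2}|lborel. \<bar>ln (1 / x) - A_const\<bar> ^ K) - exp (- A_const) * fact K\<bar>
     \<le> exp (5/4 * A_const) * (fact K * (4/5) ^ K)"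
proof -
  define b where "b = exp (- A_const)"
  have b: "0 < b" "b < 1/2" using exp_minus_A_const_less by (auto simp: b_def)
  have lnb: "ln (1 / b) = A_const" by (simp add: b_def ln_div)
  define l where "l = (\<lambda>x. \<bar>ln (1 / x) - A_const\<bar> ^ K)"
  have "{0<..<1/2} = {0<..<b} \<union> {b..<1/2}" using b by auto
  hence "(LINT x:{0<..<1/2}|lborel. l x) = (LINT x:{0<..<b} \<union> {b..<1/2}|lborel. l x)" by simp
  also have "\<dots> = (LINT x:{0<..<b}|lborel. l x) + (LINT x:{b..<1/2}|lborel. l x)"
    by (rule set_integral_Un)
       (use b in \<open>auto simp: l_def intro!: set_integrable_subset[OF int]\<close>)
  also have "(LINT x:{0<..<b}|lborel. l x) = (LINT x:{0<..<b}|lborel. (ln (1 / x) - A_const) ^ K)"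
  proof (rule set_lebesgue_integral_cong)
    show "\<forall>x. x \<in> {0<..<b} \<longrightarrow> l x = (ln (1 / x) - A_const) ^ K"
    proof (intro allI impI)
      fix x assume x: "x \<in> {0<..<b}"
      have "ln (1 / b) \<le> ln (1 / x)"
        using x b by (subst ln_le_cancel_iff) (auto simp: field_simps)
      thus "l x = (ln (1 / x) - A_const) ^ K" by (simp add: l_def lnb)
    qed
  qed auto
  also have "\<dots> = exp (- A_const) * fact K"
    unfolding b_def by (rule set_integral_log_power)
  finally have eq: "(LINT x:{0<..<1/2}|lborel. l x) - exp (- A_const) * fact K = (LINT x:{b..<1/2}|lborel. l x)"
    by simp
  have "0 \<le> (LINT x:{b..<1/2}|lborel. l x)"
    unfolding set_lebesgue_integral_def l_def by (intro integral_nonneg_AE) auto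
  moreover have "(LINT x:{b..<1/2}|lborel. l x) \<le> (LINT x:{b..<1/2}|lborel. A_const ^ K)"
  proof (rule set_integral_mono)
    show "set_integrable lborel {b..<1/2} l"
      unfolding l_def by (rule set_integrable_subset[OF int]) (use b in auto)
    show "set_integrable lborel {b..<1/2} (\<lambda>x. A_const ^ K)"
      unfolding set_integrable_def using b by (intro integrable_scaleR_left integrable_real_indicator) auto
    fix x assume x: "x \<in> {b..<1/2}"
    have "ln (1 / x) \<le> ln (1 / b)"
      using x b by (subst ln_le_cancel_iff) (auto simp: field_simps)
    moreover have "0 \<le> ln (1 / x)" using x b by simp
    ultimately show "l x \<le> A_const ^ K"
      unfolding l_def lnb by (intro power_mono) auto
  qed
  moreover have "(LINT x:{b..<1/2}|lborel. A_const ^ K) = (1/2 - b) * A_const ^ K"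
    using b by (simp add: set_lebesgue_integral_def)
  moreover have "(1/2 - b) * A_const ^ K \<le> 1 * A_const ^ K"
    using b A_const_nonneg by (intro mult_right_mono) auto
  moreover have "A_const ^ K \<le> exp (5/4 * A_const) * (fact K * (4/5) ^ K)"
    using power_le_fact_exp[of A_const "5/4" K] A_const_nonneg by (simp add: mult_ac)
  ultimately show ?thesis using eq unfolding l_def by linarith
qed

theorem theorem1p1:
  "\<exists>C>0. \<exists>\<epsilon> :: nat \<Rightarrow> real.
     \<epsilon> \<in> O(\<lambda>K. exp (- C * real K)) \<and>
     (\<forall>K. set_integrable lborel {0<..<1} (\<lambda>x. \<bar>g x\<bar> ^ K) \<and>
          (LINT x:{0<..<1}|lborel. \<bar>g x\<bar> ^ K)
            = 2 * exp (- A_const) * Gamma (real K + 1) * (1 + \<epsilon> K))"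
proof -
  obtain D where D: "D \<ge> 0"
    "\<And>n. set_integrable lborel {0<..<1/2} (\<lambda>x. \<bar>ln (1 / x) - A_const\<bar> ^ Suc n)"
    "\<And>n. \<bar>(LINT x:{0<..<1/2}|lborel. \<bar>g x\<bar> ^ Suc n) - (LINT x:{0<..<1/2}|lborel. \<bar>ln (1 / x) - A_const\<bar> ^ Suc n)\<bar>
       \<le> D * (fact (Suc n) * (4/5) ^ n)"
    by (rule half_moment_near_log_moment) blast
  define I where "I = (\<lambda>K. LINT x:{0<..<1}|lborel. \<bar>g x\<bar> ^ K)"
  define M where "M = (\<lambda>K. 2 * exp (- A_const) * fact K :: real)"
  \<comment> \<open>The exact relative error, so the identity holds for every \<open>K\<close>
    including 0; only its bound needs \<open>K >= 1\<close>, since the comparison concerns powers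
    \<open>Suc n\<close>.\<close>
  define \<epsilon> where "\<epsilon> = (\<lambda>K. I K / M K - 1)"
  \<comment> \<open>The factor 5/4 turns \<open>(4/5) ^ n\<close> into \<open>(4/5) ^ K\<close> with
    \<open>K = Suc n\<close>, and \<open>exp A_const\<close> comes from dividing by the main
    term.\<close>
  define c where "c = (D * (5/4) + exp (5/4 * A_const)) * exp A_const"
  have M0: "M K > 0" for K by (simp add: M_def)
  have bound: "norm (\<epsilon> K) \<le> c * norm (exp (- ln (5/4) * real K))" if K: "K \<ge> 1" for K
  proof -
    obtain n where n: "K = Suc n" using K by (cases K) auto
    have "\<bar>(LINT x:{0<..<1/2}|lborel. \<bar>g x\<bar> ^ K) - exp (- A_const) * fact K\<bar>
        \<le> D * (fact (Suc n) * (4/5) ^ n) + exp (5/4 * A_const) * (fact K * (4/5) ^ K)"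
      using D(3)[of n] log_moment_half[OF D(2)[of n]] unfolding n by linarith
    also have "\<dots> = (D * (5/4) + exp (5/4 * A_const)) * (fact K * (4/5) ^ K)"
      unfolding n by (simp add: algebra_simps)
    finally have "\<bar>I K - M K\<bar> \<le> 2 * ((D * (5/4) + exp (5/4 * A_const)) * (fact K * (4/5) ^ K))"
      unfolding I_def M_def set_integral_abs_g_power_half by linarith
    also have "\<dots> = c * (4/5) ^ K * M K"
      by (simp add: c_def M_def exp_minus)
    finally have "\<bar>I K - M K\<bar> / M K \<le> c * (4/5) ^ K"
      using M0[of K] by (simp add: divide_le_eq)
    moreover have "\<epsilon> K = (I K - M K) / M K"
      using M0[of K] by (simp add: \<epsilon>_def diff_divide_distrib)
    hence "\<bar>\<epsilon> K\<bar> = \<bar>I K - M K\<bar> / M K"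
      using M0[of K] by (simp add: abs_divide)
    moreover have "exp (- ln (5/4) * real K) = (4/5) ^ K"
      by (subst exp_of_nat2_mult) (simp add: exp_minus)
    ultimately show ?thesis by simp
  qed
  show ?thesis
  proof (intro exI conjI allI)
    \<comment> \<open>The witness \<open>C = ln (5/4)\<close> makes \<open>exp (- C * K)\<close>
      equal to \<open>(4/5) ^ K\<close>.\<close>
    show "ln (5/4 :: real) > 0" by simp
    show "\<epsilon> \<in> O(\<lambda>K. exp (- ln (5/4) * real K))"
      by (rule bigoI[where c = c])
         (use bound in \<open>auto intro: eventually_mono[OF eventually_ge_at_top[of 1]]\<close>)
    show "set_integrable lborel {0<..<1} (\<lambda>x. \<bar>g x\<bar> ^ K)" for K
      by (rule set_integrable_subset[OF set_integrable_abs_g_power]) auto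
    show "(LINT x:{0<..<1}|lborel. \<bar>g x\<bar> ^ K)
            = 2 * exp (- A_const) * Gamma (real K + 1) * (1 + \<epsilon> K)" for K
    proof -
      have "Gamma (real K + 1) = fact K" using Gamma_fact[of K, where 'a = real] by (simp add: add_ac)
      thus ?thesis using M0[of K] by (simp add: \<epsilon>_def I_def M_def)
    qed
  qed
qed

end
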